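(* Let $(\mathcal{X},d)$ be a finite metric space and let $\lambda_x>0$ be an arrival rate for each $x\in\mathcal{X}$. For MPMD in the Poisson arrival model with these rates, the Radius algorithm achieves a ratio of expectations of $8/(1-e^{-2})$, i.e. $$\limsup_{m\to\infty}\frac{\mathbb{E}^m_\sigma[\mathrm{Radius}(\sigma)]}{\mathbb{E}^m_\sigma[\mathrm{OPT}(\sigma)]}\le \frac{8}{1-e^{-2}}.$$
   Context: MPMD (Min-cost Perfect Matching with Delays) on a finite metric space $(\mathcal{X},d)$: the input is a sequence $\sigma$ of $m$ requests ($m$ even), each request $r$ having a location $\ell(r)\in\mathcal{X}$ and an arrival time $t(r)\ge 0$ (all distinct). A solution partitions the requests into pairs and assigns to each request a matching time $s(r)\ge t(r)$, with $s(r)=s(r')$ for matched pairs $(r,r')$. Its cost is $\sum_{(r,r')\text{ matched}} d(\ell(r),\ell(r'))+\sum_{r}(s(r)-t(r))$. An online algorithm decides at time $t$ using only requests arrived by time $t$, irrevocably. $\mathrm{OPT}(\sigma)$ is the minimum cost of any offline solution. Poisson arrival model: waiting times between consecutive requests are i.i.d. exponential with parameter $\lambda(\mathcal{X}):=\sum_{x}\lambda_x$, and each request is located at $x$ independently with probability $\lambda_x/\lambda(\mathcal{X})$, independently of waiting times (equivalently, independent Poisson processes of rate $\lambda_x$ at each point). A random sequence of length $m$ consists of $m$ such requests; $\mathbb{E}^m_\sigma$ denotes expectation over it. For $S\subseteq\mathcal{X}$, $\lambda(S)=\sum_{x\in S}\lambda_x$, and $\overline{B}(x,u)=\{y\in\mathcal{X}: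 d(x,y)\le u\}$. The radius $\rho_x$ of $x$ is the minimum $u\ge 0$ with $1/\lambda(\overline{B}(x,u))\le u$. The Radius algorithm: it computes all $\rho_x$; when request $r_i$ arrives, if some pending request $r'$ satisfies $d(\ell(r_i),\ell(r'))\le \rho_{\ell(r')}$, it matches $r_i$ with $r'$; else if some pending $r'$ satisfies $d(\ell(r_i),\ell(r'))\le\rho_{\ell(r')}+\rho_{\ell(r_i)}$, it matches $r_i$ with such an $r'$ (ties arbitrary); otherwise $r_i$ becomes pending. When the last request has arrived, all remaining pending requests are matched arbitrarily. *)

theory Defs
  imports "HOL-Probability.Probability"
begin

section \<open>Min-cost perfect matching with delays\<close>

text \<open>
  A request is a pair of a location and an arrival time. A request sequence is a list of requests
  in order of arrival; requests are referred to by their index in the list.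
\<close>

type_synonym 'a request = "'a \<times> real"

abbreviation loc :: "'a request list \<Rightarrow> nat \<Rightarrow> 'a" where
  "loc \<sigma> i \<equiv> fst (\<sigma> ! i)"

abbreviation arrival :: "'a request list \<Rightarrow> nat \<Rightarrow> real" where
  "arrival \<sigma> i \<equiv> snd (\<sigma> ! i)"

text \<open>An unordered pair of distinct indices is represented by the ordered pair with the smaller
  index first.\<close>

definition perfect_matching :: "nat set \<Rightarrow> (nat \<times> nat) set \<Rightarrow> bool" where
  "perfect_matching V M \<longleftrightarrow>
     M \<subseteq> {(i, j). i \<in> V \<and> j \<in> V \<and> i < j} \<and>
     (\<forall>k\<in>V. \<exists>!e. e \<in> M \<and> (k = fst e \<or> k = snd e))"

definition mpmd_solution :: "'a request list \<Rightarrow> (nat \<times> nat) set \<Rightarrow> (nat \<Rightarrow> real) \<Rightarrow> bool" where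
  "mpmd_solution \<sigma> M s \<longleftrightarrow>
     perfect_matching {..<length \<sigma>} M \<and>
     (\<forall>i<length \<sigma>. arrival \<sigma> i \<le> s i) \<and>
     (\<forall>(i, j)\<in>M. s i = s j)"

definition mpmd_cost ::
  "('a \<Rightarrow> 'a \<Rightarrow> real) \<Rightarrow> 'a request list \<Rightarrow> (nat \<times> nat) set \<Rightarrow> (nat \<Rightarrow> real) \<Rightarrow> real" where
  "mpmd_cost d \<sigma> M s =
     (\<Sum>(i, j)\<in>M. d (loc \<sigma> i) (loc \<sigma> j)) + (\<Sum>i<length \<sigma>. s i - arrival \<sigma> i)"

definition mpmd_OPT :: "('a \<Rightarrow> 'a \<Rightarrow> real) \<Rightarrow> 'a request list \<Rightarrow> real" where
  "mpmd_OPT d \<sigma> = Inf {mpmd_cost d \<sigma> M s | M s. mpmd_solution \<sigma> M s}"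


section \<open>The Poisson arrival model\<close>

text \<open>
  A sample point assigns to each index \<open>i < m\<close> the waiting time between requests \<open>i - 1\<close> and \<open>i\<close>
  (from time 0 if \<open>i = 0\<close>) and the location of request \<open>i\<close>.
\<close>

definition poisson_space :: "'a set \<Rightarrow> ('a \<Rightarrow> real) \<Rightarrow> nat \<Rightarrow> (nat \<Rightarrow> real \<times> 'a) measure" where
  "poisson_space X lam m =
     (\<Pi>\<^sub>M i\<in>{..<m}. density lborel (exponential_density (sum lam X))
                  \<Otimes>\<^sub>M point_measure X (\<lambda>x. ennreal (lam x / sum lam X)))"

definition poisson_requests :: "nat \<Rightarrow> (nat \<Rightarrow> real \<times> 'a) \<Rightarrow> 'a request list" where
  "poisson_requests m \<omega> = map (\<lambda>i. (snd (\<omega> i), \<Sum>j\<le>i. fst (\<omega> j))) [0..<m]"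

definition poisson_expectation ::
  "'a set \<Rightarrow> ('a \<Rightarrow> real) \<Rightarrow> nat \<Rightarrow> ('a request list \<Rightarrow> real) \<Rightarrow> ennreal" where
  "poisson_expectation X lam m f =
     (\<integral>\<^sup>+ \<omega>. ennreal (f (poisson_requests m \<omega>)) \<partial>poisson_space X lam m)"


section \<open>The Radius algorithm\<close>

definition radius :: "'a set \<Rightarrow> ('a \<Rightarrow> 'a \<Rightarrow> real) \<Rightarrow> ('a \<Rightarrow> real) \<Rightarrow> 'a \<Rightarrow> real" where
  "radius X d lam x = (LEAST u. 0 \<le> u \<and> 1 / sum lam (Metric_space.mcball X d x u) \<le> u)"

text \<open>
  The arbitrary choices of the algorithm are two parameters. The rule \<open>tie\<close> selects a partner from
  the set of admissible pending requests and may depend on all requests that have arrived so far;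
  the rule \<open>fin\<close> selects a perfect matching of the requests that are still pending after the last
  arrival.
\<close>

definition tie_rule :: "('a request list \<Rightarrow> nat set \<Rightarrow> nat) \<Rightarrow> bool" where
  "tie_rule tie \<longleftrightarrow> (\<forall>h C. finite C \<and> C \<noteq> {} \<longrightarrow> tie h C \<in> C)"

definition final_rule :: "('a request list \<Rightarrow> nat set \<Rightarrow> (nat \<times> nat) set) \<Rightarrow> bool" where
  "final_rule fin \<longleftrightarrow> (\<forall>h P. finite P \<and> even (card P) \<longrightarrow> perfect_matching P (fin h P))"

text \<open>The state \<open>(P, M, s)\<close> consists of the pending requests, the pairs matched so far, and the
  matching times of the requests in these pairs.\<close>

definition radius_step ::
  "('a \<Rightarrow> 'a \<Rightarrow> real) \<Rightarrow> ('a \<Rightarrow> real) \<Rightarrow> ('a request list \<Rightarrow> nat set \<Rightarrow> nat) \<Rightarrow> 'a request list \<Rightarrow> nat \<Rightarrow>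
   nat set \<times> (nat \<times> nat) set \<times> (nat \<Rightarrow> real) \<Rightarrow> nat set \<times> (nat \<times> nat) set \<times> (nat \<Rightarrow> real)" where
  "radius_step d \<rho> tie \<sigma> i = (\<lambda>(P, M, s).
     let C\<^sub>1 = {j \<in> P. d (loc \<sigma> i) (loc \<sigma> j) \<le> \<rho> (loc \<sigma> j)};
         C\<^sub>2 = {j \<in> P. d (loc \<sigma> i) (loc \<sigma> j) \<le> \<rho> (loc \<sigma> j) + \<rho> (loc \<sigma> i)};
         C = (if C\<^sub>1 \<noteq> {} then C\<^sub>1 else C\<^sub>2);
         j = tie (take (Suc i) \<sigma>) C
     in if C = {} then (insert i P, M, s)
        else (P - {j}, insert (j, i) M, s(i := arrival \<sigma> i, j := arrival \<sigma> i)))"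

definition radius_finish ::
  "('a request list \<Rightarrow> nat set \<Rightarrow> (nat \<times> nat) set) \<Rightarrow> 'a request list \<Rightarrow>
   nat set \<times> (nat \<times> nat) set \<times> (nat \<Rightarrow> real) \<Rightarrow> (nat \<times> nat) set \<times> (nat \<Rightarrow> real)" where
  "radius_finish fin \<sigma> = (\<lambda>(P, M, s).
     (M \<union> fin \<sigma> P, \<lambda>i. if i \<in> P then arrival \<sigma> (length \<sigma> - 1) else s i))"

definition radius_algorithm ::
  "'a set \<Rightarrow> ('a \<Rightarrow> 'a \<Rightarrow> real) \<Rightarrow> ('a \<Rightarrow> real) \<Rightarrow>
   ('a request list \<Rightarrow> nat set \<Rightarrow> nat) \<Rightarrow> ('a request list \<Rightarrow> nat set \<Rightarrow> (nat \<times> nat) set) \<Rightarrow>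
   'a request list \<Rightarrow> (nat \<times> nat) set \<times> (nat \<Rightarrow> real)" where
  "radius_algorithm X d lam tie fin \<sigma> =
     radius_finish fin \<sigma>
       (fold (radius_step d (radius X d lam) tie \<sigma>) [0..<length \<sigma>] ({}, {}, \<lambda>_. 0))"

definition radius_cost ::
  "'a set \<Rightarrow> ('a \<Rightarrow> 'a \<Rightarrow> real) \<Rightarrow> ('a \<Rightarrow> real) \<Rightarrow>
   ('a request list \<Rightarrow> nat set \<Rightarrow> nat) \<Rightarrow> ('a request list \<Rightarrow> nat set \<Rightarrow> (nat \<times> nat) set) \<Rightarrow>
   'a request list \<Rightarrow> real" where
  "radius_cost X d lam tie fin \<sigma> =
     (let (M, s) = radius_algorithm X d lam tie fin \<sigma> in mpmd_cost d \<sigma> M s)"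

end

theory Submission
  imports Defs
begin

text \<open>
  Let \<open>S\<close> be the mean of the radius over a random location. Both expected costs are compared
  with \<open>m * S\<close>.

  Upper bound: the balls \<open>B(x, \<rho> x)\<close> around pending requests are disjoint, so a pending request at \<open>x\<close>
  is matched no later than the next arrival in its ball, which is expected after time
  \<open>1 / \<lambda>(B(x, \<rho> x)) \<le> \<rho> x\<close>. Matched pairs are at distance at most the sum of their radii, and the
  boundedly many requests left at the end contribute a constant, so Radius costs at most
  \<open>2 * m * S + D\<close>. The delay bound holds pointwise for a quantity that does not mention the algorithm,
  so possibly non-measurable tie-breaking is harmless.

  Lower bound: any solution pays, for each request, at least half of the distance in space and time
  to the nearest other request. For a request at \<open>x\<close> this exceeds \<open>u \<le> \<rho> x\<close> as soon as the open ball of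
  radius \<open>\<rho> x\<close> sees no other arrival within time \<open>u\<close> before and after. By minimality of the radius that
  ball has rate at most \<open>1 / \<rho> x\<close>, so the probability is at least \<open>exp (- 2 * u / \<rho> x)\<close>, and integrating
  over \<open>u\<close> gives \<open>m * S * (1 - exp (- 2)) / 4\<close>.
\<close>

section \<open>The space of arrivals\<close>

text \<open>A renewal equation: if arrivals have rate \<open>l\<close> and each is a hit with
  probability \<open>q\<close>, then \<open>exp (- (q * l * s))\<close> is the probability of no hit
  before time \<open>s\<close>. Condition on the first wait \<open>w\<close>: beyond
  \<open>s\<close> nothing has happened, otherwise the arrival has to miss and the remaining time
  \<open>s - w\<close> has to stay free of hits. Both inductions on quiet periods peel off one
  arrival in this way, which replaces an appeal to thinning of Poisson processes.\<close>

lemma nn_integral_exponential_first_hit: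
  fixes l q s :: real
  assumes l: "0 < l" and q: "q \<le> 1" and s: "0 \<le> s"
  shows "(\<integral>\<^sup>+ w. (if s \<le> w then 1 else ennreal ((1 - q) * exp (- (q * l * (s - w)))))
             \<partial>density lborel (exponential_density l)) = ennreal (exp (- (q * l * s)))"
proof -
  let ?f = "\<lambda>w. (1 - q) * l * exp (- (q * l * s)) * exp (- ((1 - q) * l * w))"
  let ?g = "\<lambda>w. l * exp (- w * l)"
  have "(\<integral>\<^sup>+ w. (if s \<le> w then 1 else ennreal ((1 - q) * exp (- (q * l * (s - w)))))
             \<partial>density lborel (exponential_density l))
      = (\<integral>\<^sup>+ w. ennreal (exponential_density l w) *
           (if s \<le> w then 1 else ennreal ((1 - q) * exp (- (q * l * (s - w))))) \<partial>lborel)"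
    by (subst nn_integral_density) auto
  also have "\<dots> = (\<integral>\<^sup>+ w. ennreal (?g w) * indicator {s..} w + ennreal (?f w) * indicator {0..s} w \<partial>lborel)"
  \<comment> \<open>The two closed ranges meet in \<open>s\<close>, where both summands would count;
    this single point is discarded as a null set.\<close>
  proof (rule nn_integral_cong_AE, use AE_lborel_singleton[of s] in eventually_elim)
    case (elim w)
    have "l * exp (- w * l) * ((1 - q) * exp (- (q * l * (s - w)))) = ?f w"
      by (simp add: exp_add[symmetric] algebra_simps)
    then show ?case
      using elim s l q
      by (auto simp: exponential_density_def ennreal_mult'[symmetric] split: split_indicator)
  qed
  also have "\<dots> = (\<integral>\<^sup>+ w. ennreal (?g w) * indicator {s..} w \<partial>lborel)
                + (\<integral>\<^sup>+ w. ennreal (?f w) * indicator {0..s} w \<partial>lborel)"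
    by (rule nn_integral_add) auto
  also have "(\<integral>\<^sup>+ w. ennreal (?g w) * indicator {s..} w \<partial>lborel) = ennreal (0 - (- exp (- s * l)))"
  proof (rule nn_integral_FTC_atLeast)
    show "((\<lambda>w. - exp (- w * l)) \<longlongrightarrow> 0) at_top"
      using l by real_asymp
  qed (use l in \<open>auto intro!: derivative_eq_intros\<close>)
  also have "(\<integral>\<^sup>+ w. ennreal (?f w) * indicator {0..s} w \<partial>lborel)
     = ennreal ((- (exp (- (q * l * s)) * exp (- ((1 - q) * l * s))))
           - (- (exp (- (q * l * s)) * exp (- ((1 - q) * l * 0)))))"
    by (rule nn_integral_FTC_Icc[where F="\<lambda>w. - (exp (- (q * l * s)) * exp (- ((1 - q) * l * w)))"])
       (use l q s in \<open>auto intro!: derivative_eq_intros\<close>)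
  also have "ennreal (0 - (- exp (- s * l))) + \<dots> = ennreal (exp (- (q * l * s)))"
  proof -
    have e: "exp (- (q * l * s)) * exp (- ((1 - q) * l * s)) = exp (- s * l)"
      by (simp add: exp_add[symmetric] algebra_simps)
    have "exp (- s * l) \<le> exp (- (q * l * s))"
      using mult_right_mono[OF q, of "l * s"] l s by (simp add: ac_simps)
    then show ?thesis
      unfolding e by (subst ennreal_plus[symmetric]) auto
  qed
  finally show ?thesis .
qed

section \<open>The product space of waits and locations: marginals, iterated integrals,
  measurability\<close>

locale poisson_arrivals =
  fixes X :: "'a set" and lam :: "'a \<Rightarrow> real"
  assumes finite_X: "finite X" and X_ne: "X \<noteq> {}" and lam_pos: "x \<in> X \<Longrightarrow> 0 < lam x"
begin

abbreviation "rate \<equiv> sum lam X"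
abbreviation "waiting \<equiv> density lborel (exponential_density rate)"
abbreviation "arrival_law \<equiv> waiting \<Otimes>\<^sub>M point_measure X (\<lambda>x. ennreal (lam x / rate))"
abbreviation "sample_space \<equiv> poisson_space X lam"

lemma rate_pos: "0 < rate"
  using finite_X X_ne lam_pos by (rule sum_pos)

lemma lam_nonneg: "x \<in> X \<Longrightarrow> 0 \<le> lam x"
  using lam_pos by (simp add: less_imp_le)

lemma sum_lam_le: "B \<subseteq> X \<Longrightarrow> sum lam B \<le> rate"
  using finite_X lam_nonneg by (intro sum_mono2) auto

lemma prob_sum: "(\<Sum>x\<in>X. lam x / rate) = 1"
  using rate_pos by (simp add: sum_divide_distrib[symmetric])

lemma prob_space_waiting: "prob_space waiting"
  by (rule prob_space_exponential_density[OF rate_pos])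

lemma emeasure_waiting_UNIV: "emeasure waiting UNIV = 1"
  using prob_space.emeasure_space_1[OF prob_space_waiting] by simp

lemma prob_space_location: "prob_space (point_measure X (\<lambda>x. ennreal (lam x / rate)))"
proof
  show "emeasure (point_measure X (\<lambda>x. ennreal (lam x / rate)))
      (space (point_measure X (\<lambda>x. ennreal (lam x / rate)))) = 1"
    using finite_X lam_nonneg rate_pos prob_sum
    by (simp add: space_point_measure emeasure_point_measure_finite sum_ennreal)
qed

lemma prob_space_arrival_law: "prob_space arrival_law"
  by (intro prob_space_pair prob_space_waiting prob_space_location)

lemma prob_space_poisson: "prob_space (sample_space m)"
  unfolding poisson_space_def by (intro prob_space_PiM prob_space_arrival_law)

lemma site_in_X: "\<eta> \<in> space (sample_space m) \<Longrightarrow> i < m \<Longrightarrow> snd (\<eta> i) \<in> X"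
  by (auto simp: poisson_space_def space_PiM space_pair_measure space_point_measure PiE_iff mem_Times_iff)

lemma AE_waiting_nonneg: "AE w in waiting. 0 \<le> w"
  by (subst AE_density) (auto simp: exponential_density_def)

text \<open>Waits range over all reals and the density merely gives no mass to negative ones, so
  arrival times are monotone only almost surely.\<close>

lemma AE_wait_nonneg: "AE \<eta> in sample_space m. \<forall>i<m. 0 \<le> fst (\<eta> i)"
proof -
  interpret prob_space "point_measure X (\<lambda>x. ennreal (lam x / rate))"
    by (rule prob_space_location)
  have "AE y in arrival_law. 0 \<le> fst y"
    by (rule AE_distrD[where f=fst and M'=waiting], simp) (subst distr_pair_fst, rule AE_waiting_nonneg)
  then have "AE \<eta> in sample_space m. 0 \<le> fst (\<eta> i)" if "i < m" for i
    unfolding poisson_space_def using that prob_space_arrival_law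
    by (intro AE_PiM_component) auto
  then have "AE \<eta> in sample_space m. \<forall>i\<in>{..<m}. 0 \<le> fst (\<eta> i)"
    by (intro AE_finite_allI) auto
  then show ?thesis by (simp add: Ball_def)
qed

lemma nn_integral_arrival_law:
  assumes [measurable]: "f \<in> borel_measurable arrival_law"
  shows "(\<integral>\<^sup>+ y. f y \<partial>arrival_law)
       = (\<integral>\<^sup>+ w. (\<Sum>x\<in>X. ennreal (lam x / rate) * f (w, x)) \<partial>waiting)"
proof -
  interpret prob_space "point_measure X (\<lambda>x. ennreal (lam x / rate))"
    by (rule prob_space_location)
  show ?thesis
    by (subst nn_integral_fst[symmetric]) (auto simp: nn_integral_point_measure_finite finite_X)
qed

text \<open>Two orders of integration for two kinds of induction: the first fixes the past and
  averages over the newest arrival, the second fixes the newest arrival and averages over the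
  past.\<close>

lemma nn_integral_poisson_Suc:
  assumes "f \<in> borel_measurable (sample_space (Suc m))"
  shows "(\<integral>\<^sup>+ \<eta>. f \<eta> \<partial>(sample_space (Suc m))) = (\<integral>\<^sup>+ \<eta>. (\<integral>\<^sup>+ y. f (\<eta>(m := y)) \<partial>arrival_law) \<partial>(sample_space m))"
    and "(\<integral>\<^sup>+ \<eta>. f \<eta> \<partial>(sample_space (Suc m))) = (\<integral>\<^sup>+ y. (\<integral>\<^sup>+ \<eta>. f (\<eta>(m := y)) \<partial>(sample_space m)) \<partial>arrival_law)"
proof -
  interpret product_sigma_finite "\<lambda>_::nat. arrival_law"
    using prob_space_arrival_law
    by (intro product_sigma_finite.intro prob_space_imp_sigma_finite)
  show "(\<integral>\<^sup>+ \<eta>. f \<eta> \<partial>(sample_space (Suc m))) = (\<integral>\<^sup>+ \<eta>. (\<integral>\<^sup>+ y. f (\<eta>(m := y)) \<partial>arrival_law) \<partial>(sample_space m))"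
    using assms product_nn_integral_insert[of "{..<m}" m f]
    by (simp add: poisson_space_def lessThan_Suc)
  show "(\<integral>\<^sup>+ \<eta>. f \<eta> \<partial>(sample_space (Suc m))) = (\<integral>\<^sup>+ y. (\<integral>\<^sup>+ \<eta>. f (\<eta>(m := y)) \<partial>(sample_space m)) \<partial>arrival_law)"
    using assms product_nn_integral_insert_rev[of "{..<m}" m f]
    by (simp add: poisson_space_def lessThan_Suc)
qed

lemma measurable_wait[measurable]: "i < m \<Longrightarrow> (\<lambda>\<eta>. fst (\<eta> i)) \<in> borel_measurable (sample_space m)"
  unfolding poisson_space_def by measurable

lemma measurable_site[measurable]: "i < m \<Longrightarrow> (\<lambda>\<eta>. snd (\<eta> i)) \<in> measurable (sample_space m) (count_space X)"
  unfolding poisson_space_def by measurable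

lemma measurable_arrival_snd[measurable]: "snd \<in> measurable arrival_law (count_space X)"
  by measurable

lemma measurable_fun_of_site:
  "i < m \<Longrightarrow> (\<lambda>\<eta>. h (snd (\<eta> i)) :: ennreal) \<in> borel_measurable (sample_space m)"
  by (rule measurable_compose[OF measurable_site]) auto

lemma nn_integral_site:
  assumes "i < m"
  shows "(\<integral>\<^sup>+ \<eta>. h (snd (\<eta> i)) \<partial>(sample_space m)) = (\<Sum>x\<in>X. ennreal (lam x / rate) * h x)"
proof -
  have h: "(\<lambda>y. h (snd y)) \<in> borel_measurable arrival_law"
    by (rule measurable_compose[OF measurable_arrival_snd]) auto
  have "(\<Sum>x\<in>X. ennreal (lam x / rate) * h x) = (\<integral>\<^sup>+ y. h (snd y) \<partial>arrival_law)"
    by (simp add: nn_integral_arrival_law[OF h] emeasure_waiting_UNIV)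
  also have "\<dots> = (\<integral>\<^sup>+ y. h (snd y) \<partial>distr (sample_space m) arrival_law (\<lambda>\<eta>. \<eta> i))"
    unfolding poisson_space_def using assms prob_space_arrival_law
    by (subst distr_PiM_component) auto
  also have "\<dots> = (\<integral>\<^sup>+ \<eta>. h (snd (\<eta> i)) \<partial>(sample_space m))"
    using assms h by (subst nn_integral_distr) (auto simp: poisson_space_def)
  finally show ?thesis by simp
qed

section \<open>Waiting for a hit\<close>

lemma nn_integral_wait: "(\<integral>\<^sup>+ y. ennreal (fst y) \<partial>arrival_law) = ennreal (1 / rate)"
proof -
  have "(\<integral>\<^sup>+ y. ennreal (fst y) \<partial>arrival_law) = (\<integral>\<^sup>+ w. ennreal w \<partial>waiting)"
    using prob_sum lam_nonneg rate_pos
    by (subst nn_integral_arrival_law) (auto simp: sum_distrib_right[symmetric] sum_ennreal)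
  also have "\<dots> = (\<integral>\<^sup>+ w. ennreal (exponential_density rate w * w ^ 1) \<partial>lborel)"
    using rate_pos
    by (subst nn_integral_density) (auto simp: ennreal_mult'[symmetric] exponential_density_nonneg)
  also have "\<dots> = ennreal (1 / rate)"
    by (subst nn_integral_erlang_ith_moment[OF rate_pos]) simp
  finally show ?thesis .
qed

lemma sum_prob_avoiding:
  assumes "B \<subseteq> X"
  shows "(\<Sum>x\<in>X. ennreal (lam x / rate) * (if x \<in> B then 0 else 1)) = ennreal (1 - sum lam B / rate)"
proof -
  have "(\<Sum>x\<in>X. ennreal (lam x / rate) * (if x \<in> B then 0 else 1))
      = (\<Sum>x\<in>X. ennreal (if x \<in> B then 0 else lam x / rate))"
    by (rule sum.cong) auto
  also have "\<dots> = ennreal (\<Sum>x\<in>X. if x \<in> B then 0 else lam x / rate)"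
    using lam_nonneg rate_pos by (intro sum_ennreal) auto
  also have "(\<Sum>x\<in>X. if x \<in> B then 0 else lam x / rate) = (\<Sum>x\<in>X - B. lam x / rate)"
    using finite_X by (intro sum.mono_neutral_cong_right) auto
  also have "\<dots> = 1 - sum lam B / rate"
    using finite_X assms rate_pos
    by (simp add: sum_diff sum_divide_distrib[symmetric] diff_divide_distrib)
  finally show ?thesis .
qed

lemma nn_integral_avoiding:
  assumes "B \<subseteq> X"
  shows "(\<integral>\<^sup>+ y. (if snd y \<in> B then 0 else 1) \<partial>arrival_law) = ennreal (1 - sum lam B / rate)"
proof -
  have m: "(\<lambda>y. if snd y \<in> B then 0 else 1 :: ennreal) \<in> borel_measurable arrival_law"
    by (rule measurable_compose[OF measurable_arrival_snd]) auto
  show ?thesis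
    by (subst nn_integral_arrival_law[OF m])
       (use sum_prob_avoiding[OF assms] emeasure_waiting_UNIV in simp)
qed

text \<open>\<open>R\<close> is arbitrary: as \<open>X\<close> is finite, the event splits into
  finitely many cases according to the first location.\<close>

lemma measurable_site_pair [measurable]:
  assumes "i < m" "j < m"
  shows "Measurable.pred (sample_space m) (\<lambda>\<eta>. R (snd (\<eta> i)) (snd (\<eta> j)))"
proof -
  have "Measurable.pred (sample_space m) (\<lambda>\<eta>. \<exists>x\<in>X. snd (\<eta> i) = x \<and> R x (snd (\<eta> j)))"
    using assms finite_X
    by (intro pred_intros_finite pred_intros_logic)
       (auto intro!: measurable_compose[OF measurable_site])
  then show ?thesis
    using assms site_in_X by (subst measurable_cong[where g="\<lambda>\<eta>. \<exists>x\<in>X. snd (\<eta> i) = x \<and> R x (snd (\<eta> j))"]) auto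
qed

text \<open>Index \<open>j\<close> itself is excluded, so the wait that ends with the first hit
  still carries the factor 1. Summing wait times factor over \<open>j\<close> therefore gives the
  time from request \<open>i\<close> to its first hit.\<close>

definition unhit :: "('a \<Rightarrow> 'a set) \<Rightarrow> (nat \<Rightarrow> real \<times> 'a) \<Rightarrow> nat \<Rightarrow> nat \<Rightarrow> ennreal" where
  "unhit B \<eta> i j = (if \<forall>l\<in>{i<..<j}. snd (\<eta> l) \<notin> B (snd (\<eta> i)) then 1 else 0)"

lemma measurable_unhit [measurable]:
  assumes "i < m" "j \<le> m"
  shows "(\<lambda>\<eta>. unhit B \<eta> i j) \<in> borel_measurable (sample_space m)"
proof -
  have "Measurable.pred (sample_space m) (\<lambda>\<eta>. \<forall>l\<in>{i<..<j}. snd (\<eta> l) \<notin> B (snd (\<eta> i)))"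
    using assms by (intro pred_intros_finite measurable_site_pair[where R="\<lambda>x y. y \<notin> B x"]) auto
  then show ?thesis unfolding unhit_def by measurable
qed

text \<open>The integrand is the time from request \<open>i\<close> at \<open>x\<close> to the first
  later arrival in \<open>B x\<close>, cut off at the end of the sequence. Without the cut its mean
  would be \<open>1 / sum lam (B x)\<close>; the cut accounts for the inequality.\<close>

lemma expected_unhit_wait:
  assumes B: "\<And>x. x \<in> X \<Longrightarrow> B x \<subseteq> X" "\<And>x. x \<in> X \<Longrightarrow> x \<in> B x" and "i < m"
  shows "(\<integral>\<^sup>+ \<eta>. (\<Sum>j\<in>{i<..<m}. ennreal (fst (\<eta> j)) * unhit B \<eta> i j) \<partial>(sample_space m))
       \<le> (\<Sum>x\<in>X. ennreal (lam x / rate) * ennreal (1 / sum lam (B x)))"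
proof -
  let ?c = "\<lambda>x. ennreal (1 / sum lam (B x))"
  let ?S = "\<lambda>m \<eta>. \<Sum>j\<in>{i<..<m}. ennreal (fst (\<eta> j)) * unhit B \<eta> i j"
  let ?W = "\<lambda>m \<eta>. ?S m \<eta> + unhit B \<eta> i m * ?c (snd (\<eta> i))"
  have W_meas: "?W m \<in> borel_measurable (sample_space m)" if "i < m" for m
  proof -
    have [measurable]: "(\<lambda>\<eta>. ?c (snd (\<eta> i))) \<in> borel_measurable (sample_space m)"
      using that by (rule measurable_fun_of_site)
    have [measurable]: "(\<lambda>\<eta>. fst (\<eta> j)) \<in> borel_measurable (sample_space m)"
      and [measurable]: "(\<lambda>\<eta>. unhit B \<eta> i j) \<in> borel_measurable (sample_space m)"
      if "j \<in> {i<..<m}" for j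
      using that by auto
    have [measurable]: "(\<lambda>\<eta>. unhit B \<eta> i m) \<in> borel_measurable (sample_space m)"
      using that by auto
    show ?thesis by measurable
  qed
  \<comment> \<open>A request that has not been hit yet still expects to wait \<open>?c\<close>, so that the total expectation
    of \<open>?W m\<close> does not depend on \<open>m\<close>.\<close>
  have "Suc i \<le> m \<Longrightarrow> (\<integral>\<^sup>+ \<eta>. ?W m \<eta> \<partial>(sample_space m)) = (\<Sum>x\<in>X. ennreal (lam x / rate) * ?c x)"
  proof (induction m rule: dec_induct)
    case base
    have "{i<..<Suc i} = {}" by auto
    then show ?case using nn_integral_site[where h="?c" and i=i and m="Suc i"] by (simp add: unhit_def)
  next
    case (step m)
    then have "i < m" by simp
    have eq: "(\<integral>\<^sup>+ y. ?W (Suc m) (\<eta>(m := y)) \<partial>arrival_law) = ?W m \<eta>" if \<eta>: "\<eta> \<in> space (sample_space m)" for \<eta>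
    proof -
      interpret A: prob_space arrival_law by (rule prob_space_arrival_law)
      define x where "x = snd (\<eta> i)"
      have x: "x \<in> X" using site_in_X[OF \<eta> \<open>i < m\<close>] by (simp add: x_def)
      define b where "b = sum lam (B x)"
      have "finite (B x)" using B(1)[OF x] finite_X finite_subset by blast
      then have b: "0 < b" "b \<le> rate"
        using B(1)[OF x] B(2)[OF x] lam_pos sum_lam_le unfolding b_def by (auto intro!: sum_pos)
      have u: "unhit B (\<eta>(m := y)) i j = unhit B \<eta> i j" if "j \<le> m" for y j
        using that \<open>i < m\<close> by (auto simp: unhit_def)
      have set_eq: "{i<..<Suc m} = insert m {i<..<m}" using \<open>i < m\<close> by auto
      then have u2: "unhit B (\<eta>(m := y)) i (Suc m) = unhit B \<eta> i m * (if snd y \<in> B x then 0 else 1)" for y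
        using \<open>i < m\<close> by (auto simp: unhit_def x_def)
      from set_eq have S: "?S (Suc m) (\<eta>(m := y)) = ennreal (fst y) * unhit B \<eta> i m + ?S m \<eta>" for y
        using u by simp
      have m1: "(\<lambda>y. if snd y \<in> B x then 0 else 1 :: ennreal) \<in> borel_measurable arrival_law"
        by (rule measurable_compose[OF measurable_arrival_snd]) auto
      have "(\<integral>\<^sup>+ y. ?W (Suc m) (\<eta>(m := y)) \<partial>arrival_law)
          = (\<integral>\<^sup>+ y. unhit B \<eta> i m * ennreal (fst y) + (?S m \<eta>
               + (unhit B \<eta> i m * ?c x) * (if snd y \<in> B x then 0 else 1)) \<partial>arrival_law)"
        unfolding S u2 using \<open>i < m\<close> by (intro nn_integral_cong) (auto simp: x_def ac_simps)
      also have "\<dots> = unhit B \<eta> i m * ennreal (1 / rate) + (?S m \<eta>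
               + (unhit B \<eta> i m * ?c x) * ennreal (1 - b / rate))"
        using m1 by (simp add: nn_integral_add nn_integral_cmult nn_integral_wait A.emeasure_space_1
          nn_integral_avoiding[OF B(1)[OF x]] b_def)
      also have "\<dots> = ?S m \<eta> + unhit B \<eta> i m * (ennreal (1 / rate) + ennreal (1 / b) * ennreal (1 - b / rate))"
        by (simp add: b_def distrib_left ac_simps)
      \<comment> \<open>The mean time \<open>1 / b\<close> to a hit satisfies this fixed-point
        equation: one wait, then with probability \<open>1 - b / rate\<close> a fresh start.\<close>
      also have "ennreal (1 / rate) + ennreal (1 / b) * ennreal (1 - b / rate) = ennreal (1 / b)"
        using b rate_pos
        by (simp add: ennreal_mult'[symmetric] ennreal_plus[symmetric] field_simps del: ennreal_plus)
      finally show ?thesis unfolding b_def x_def .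
    qed
    have "(\<integral>\<^sup>+ \<eta>. ?W (Suc m) \<eta> \<partial>(sample_space (Suc m))) = (\<integral>\<^sup>+ \<eta>. ?W m \<eta> \<partial>(sample_space m))"
      using \<open>i < m\<close> by (subst nn_integral_poisson_Suc(1)[OF W_meas]) (auto intro!: nn_integral_cong eq simp del: fun_upd_apply)
    with step.IH show ?case by simp
  qed
  moreover have "(\<integral>\<^sup>+ \<eta>. ?S m \<eta> \<partial>(sample_space m)) \<le> (\<integral>\<^sup>+ \<eta>. ?W m \<eta> \<partial>(sample_space m))"
    by (intro nn_integral_mono) auto
  ultimately show ?thesis using \<open>i < m\<close> by (simp add: Suc_le_eq)
qed

section \<open>Quiet periods around an arrival\<close>

text \<open>Time gaps are written as sums of waits instead of differences of arrival times. Thus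
  \<open>quiet_before\<close> involves only coordinates up to \<open>i\<close> and
  \<open>quiet_after\<close> only coordinates beyond \<open>i\<close>, which makes the two events
  independent.\<close>

definition quiet_before :: "'a set \<Rightarrow> (nat \<Rightarrow> real \<times> 'a) \<Rightarrow> nat \<Rightarrow> real \<Rightarrow> bool" where
  "quiet_before B \<eta> i u \<longleftrightarrow> (\<forall>j\<in>{..<i}. snd (\<eta> j) \<in> B \<longrightarrow> u \<le> (\<Sum>k\<in>{j<..i}. fst (\<eta> k)))"

definition quiet_after :: "'a set \<Rightarrow> (nat \<Rightarrow> real \<times> 'a) \<Rightarrow> nat \<Rightarrow> nat \<Rightarrow> real \<Rightarrow> bool" where
  "quiet_after B \<eta> i m u \<longleftrightarrow> (\<forall>j\<in>{i<..<m}. snd (\<eta> j) \<in> B \<longrightarrow> u \<le> (\<Sum>k\<in>{i<..j}. fst (\<eta> k)))"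

lemma measurable_site_mem: "j < m \<Longrightarrow> Measurable.pred (sample_space m) (\<lambda>\<eta>. snd (\<eta> j) \<in> B)"
  by (rule measurable_compose[OF measurable_site]) auto

text \<open>Measurability is joint in the sample point and \<open>u\<close>, because
  \<open>expected_quiet_time\<close> exchanges the integrals over both.\<close>

lemma measurable_quiet:
  assumes "i < m" "n \<le> m"
  shows "Measurable.pred (sample_space m \<Otimes>\<^sub>M borel) (\<lambda>(\<eta>, u). quiet_before B \<eta> i u)"
    and "Measurable.pred (sample_space m \<Otimes>\<^sub>M borel) (\<lambda>(\<eta>, u). quiet_after B \<eta> i n u)"
proof -
  have site: "Measurable.pred (sample_space m \<Otimes>\<^sub>M borel) (\<lambda>p. snd (fst p j) \<in> B)" if "j < m" for j
    using that measurable_compose[OF measurable_fst measurable_site_mem] by blast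
  have wait: "(\<lambda>p. fst (fst p k)) \<in> borel_measurable (sample_space m \<Otimes>\<^sub>M borel)" if "k < m" for k
    using that measurable_compose[OF measurable_fst measurable_wait] by blast
  have gap: "Measurable.pred (sample_space m \<Otimes>\<^sub>M borel) (\<lambda>p. snd p \<le> (\<Sum>k\<in>K. fst (fst p k)))"
    if "K \<subseteq> {..<m}" for K
  proof -
    have [measurable]: "(\<lambda>p. \<Sum>k\<in>K. fst (fst p k)) \<in> borel_measurable (sample_space m \<Otimes>\<^sub>M borel)"
      using that by (intro borel_measurable_sum wait) auto
    show ?thesis by measurable
  qed
  show "Measurable.pred (sample_space m \<Otimes>\<^sub>M borel) (\<lambda>(\<eta>, u). quiet_before B \<eta> i u)"
    unfolding quiet_before_def case_prod_unfold using assms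
    by (intro pred_intros_finite pred_intros_logic site gap) auto
  show "Measurable.pred (sample_space m \<Otimes>\<^sub>M borel) (\<lambda>(\<eta>, u). quiet_after B \<eta> i n u)"
    unfolding quiet_after_def case_prod_unfold using assms
    by (intro pred_intros_finite pred_intros_logic site gap) auto
qed

lemma measurable_quiet_before [measurable]:
  "i < m \<Longrightarrow> Measurable.pred (sample_space m) (\<lambda>\<eta>. quiet_before B \<eta> i u)"
  using measurable_compose[OF measurable_Pair2' measurable_quiet(1)[where m=m and n=m]]
  by simp

lemma measurable_quiet_after [measurable]:
  "i < m \<Longrightarrow> n \<le> m \<Longrightarrow> Measurable.pred (sample_space m) (\<lambda>\<eta>. quiet_after B \<eta> i n u)"
  using measurable_compose[OF measurable_Pair2' measurable_quiet(2)[where m=m]]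
  by simp

text \<open>Look back from request \<open>Suc i\<close> over its wait \<open>w\<close>. If
  \<open>w\<close> reaches \<open>u\<close>, the period is quiet; otherwise request \<open>i\<close>
  has to miss \<open>B\<close> and be preceded by a quiet period of length \<open>u - w\<close>. The
  weight \<open>h\<close> is general because the induction hypothesis is applied with the indicator
  of missing \<open>B\<close>. It is only an inequality since nothing arrives before request
  0.\<close>

lemma nn_integral_quiet_before:
  assumes B: "B \<subseteq> X" and u: "0 \<le> u"
  shows "(\<Sum>x\<in>X. ennreal (lam x / rate) * h x) * ennreal (exp (- (sum lam B * u)))
       \<le> (\<integral>\<^sup>+ \<eta>. h (snd (\<eta> i)) * (if quiet_before B \<eta> i u then 1 else 0) \<partial>(sample_space (Suc i)))"
  using u
proof (induction i arbitrary: h u)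
  case 0
  have "exp (- (sum lam B * u)) \<le> 1"
    using B lam_nonneg 0 by (auto intro!: mult_nonneg_nonneg sum_nonneg)
  then have "(\<Sum>x\<in>X. ennreal (lam x / rate) * h x) * ennreal (exp (- (sum lam B * u)))
      \<le> (\<Sum>x\<in>X. ennreal (lam x / rate) * h x) * 1"
    by (intro mult_left_mono) auto
  then show ?case by (simp add: quiet_before_def nn_integral_site)
next
  case (Suc i)
  let ?q = "sum lam B / rate"
  let ?G = "\<lambda>w. if u \<le> w then 1 else ennreal ((1 - ?q) * exp (- (?q * rate * (u - w))))"
  let ?Q = "\<lambda>\<eta>. h (snd (\<eta> (Suc i))) * (if quiet_before B \<eta> (Suc i) u then 1 else 0)"
  interpret P: prob_space "sample_space (Suc i)" by (rule prob_space_poisson)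
  have q: "?q \<le> 1" using sum_lam_le[OF B] rate_pos by simp
  have h: "(\<lambda>y. h (snd y) * ?G (fst y)) \<in> borel_measurable arrival_law"
  proof -
    have [measurable]: "(\<lambda>y. h (snd y)) \<in> borel_measurable arrival_law"
      by (rule measurable_compose[OF measurable_arrival_snd]) auto
    show ?thesis by measurable
  qed
  have set_eq: "{j<..Suc i} = insert (Suc i) {j<..i}" if "j \<le> i" for j
    using that by auto
  have "h (snd y) * ?G (fst y) \<le> (\<integral>\<^sup>+ \<eta>. ?Q (\<eta>(Suc i := y)) \<partial>(sample_space (Suc i)))" for y
  proof (cases "u \<le> fst y")
    case True
    have "h (snd y) * ?G (fst y) = (\<integral>\<^sup>+ \<eta>. h (snd y) \<partial>(sample_space (Suc i)))"
      using True by (simp add: P.emeasure_space_1)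
    also have "\<dots> \<le> (\<integral>\<^sup>+ \<eta>. ?Q (\<eta>(Suc i := y)) \<partial>(sample_space (Suc i)))"
    \<comment> \<open>The last wait alone covers \<open>u\<close>; earlier waits cannot shorten a
      gap when they are nonnegative.\<close>
    proof (rule nn_integral_mono_AE, use AE_wait_nonneg[of "Suc i"] in eventually_elim)
      case (elim \<eta>)
      have "u \<le> (\<Sum>k\<in>{j<..Suc i}. fst ((\<eta>(Suc i := y)) k))" if "j \<le> i" for j
      proof -
        have "(\<Sum>k\<in>{j<..Suc i}. fst ((\<eta>(Suc i := y)) k)) = fst y + (\<Sum>k\<in>{j<..i}. fst (\<eta> k))"
          using that by (simp add: set_eq)
        moreover have "0 \<le> (\<Sum>k\<in>{j<..i}. fst (\<eta> k))"
          using elim by (intro sum_nonneg) auto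
        ultimately show ?thesis using True by simp
      qed
      then have "quiet_before B (\<eta>(Suc i := y)) (Suc i) u"
        unfolding quiet_before_def by (auto simp del: fun_upd_apply)
      then show ?case by simp
    qed
    finally show ?thesis .
  next
    case False
    let ?a = "\<lambda>x. if x \<in> B then 0 else 1 :: ennreal"
    \<comment> \<open>The factor \<open>1 - ?q\<close> is read as the probability that request
      \<open>i\<close> misses \<open>B\<close>, which gives the expression the shape of the
      induction hypothesis with \<open>?a\<close> for \<open>h\<close>.\<close>
    have "h (snd y) * ?G (fst y)
        = h (snd y) * ((\<Sum>x\<in>X. ennreal (lam x / rate) * ?a x) * ennreal (exp (- (sum lam B * (u - fst y)))))"
      using False q rate_pos by (simp add: sum_prob_avoiding[OF B] ennreal_mult'[symmetric])
    also have "\<dots> \<le> h (snd y) * (\<integral>\<^sup>+ \<eta>. ?a (snd (\<eta> i)) * (if quiet_before B \<eta> i (u - fst y) then 1 else 0)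
                        \<partial>(sample_space (Suc i)))"
      using False by (intro mult_left_mono Suc.IH) auto
    also have "\<dots> = (\<integral>\<^sup>+ \<eta>. h (snd y) * (?a (snd (\<eta> i)) * (if quiet_before B \<eta> i (u - fst y) then 1 else 0))
                        \<partial>(sample_space (Suc i)))"
      by (intro nn_integral_cmult[symmetric] borel_measurable_times_ennreal measurable_fun_of_site
            measurable_If measurable_quiet_before) auto
    also have "\<dots> \<le> (\<integral>\<^sup>+ \<eta>. ?Q (\<eta>(Suc i := y)) \<partial>(sample_space (Suc i)))"
    proof (rule nn_integral_mono)
      fix \<eta>
      have "quiet_before B (\<eta>(Suc i := y)) (Suc i) u"
        if "snd (\<eta> i) \<notin> B" "quiet_before B \<eta> i (u - fst y)"
        unfolding quiet_before_def
      proof (intro ballI impI)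
        fix j assume j: "j \<in> {..<Suc i}" "snd ((\<eta>(Suc i := y)) j) \<in> B"
        with that(1) have "j < i" by (cases "j = i") auto
        moreover have "(\<Sum>k\<in>{j<..Suc i}. fst ((\<eta>(Suc i := y)) k)) = fst y + (\<Sum>k\<in>{j<..i}. fst (\<eta> k))"
          using \<open>j < i\<close> by (simp add: set_eq)
        ultimately show "u \<le> (\<Sum>k\<in>{j<..Suc i}. fst ((\<eta>(Suc i := y)) k))"
          using that(2) j by (auto simp: quiet_before_def)
      qed
      then show "h (snd y) * (?a (snd (\<eta> i)) * (if quiet_before B \<eta> i (u - fst y) then 1 else 0))
          \<le> ?Q (\<eta>(Suc i := y))"
        by simp
    qed
    finally show ?thesis .
  qed
  then have "(\<integral>\<^sup>+ y. h (snd y) * ?G (fst y) \<partial>arrival_law)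
      \<le> (\<integral>\<^sup>+ y. (\<integral>\<^sup>+ \<eta>. ?Q (\<eta>(Suc i := y)) \<partial>(sample_space (Suc i))) \<partial>arrival_law)"
    by (intro nn_integral_mono)
  also have "\<dots> = (\<integral>\<^sup>+ \<eta>. ?Q \<eta> \<partial>(sample_space (Suc (Suc i))))"
    by (rule nn_integral_poisson_Suc(2)[symmetric])
       (auto intro!: borel_measurable_times_ennreal measurable_fun_of_site measurable_If measurable_quiet_before)
  finally have "(\<integral>\<^sup>+ y. h (snd y) * ?G (fst y) \<partial>arrival_law) \<le> \<dots>" .
  moreover have "(\<integral>\<^sup>+ y. h (snd y) * ?G (fst y) \<partial>arrival_law)
      = (\<Sum>x\<in>X. ennreal (lam x / rate) * h x) * ennreal (exp (- (sum lam B * u)))"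
  proof -
    have "(\<integral>\<^sup>+ y. h (snd y) * ?G (fst y) \<partial>arrival_law)
        = (\<integral>\<^sup>+ w. (\<Sum>x\<in>X. ennreal (lam x / rate) * h x) * ?G w \<partial>waiting)"
      unfolding nn_integral_arrival_law[OF h]
      by (intro nn_integral_cong) (simp add: sum_distrib_right mult.assoc)
    also have "\<dots> = (\<Sum>x\<in>X. ennreal (lam x / rate) * h x) * (\<integral>\<^sup>+ w. ?G w \<partial>waiting)"
      by (intro nn_integral_cmult) auto
    also have "(\<integral>\<^sup>+ w. ?G w \<partial>waiting) = ennreal (exp (- (?q * rate * u)))"
      by (rule nn_integral_exponential_first_hit[OF rate_pos q Suc.prems])
    finally show ?thesis using rate_pos by simp
  qed
  ultimately show ?case by simp
qed

text \<open>One step of the renewal equation with wait and location of the new arrival kept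
  together. Here \<open>s\<close> is the quiet time still required, and \<open>max 0\<close> covers
  the case that it has already elapsed.\<close>

lemma nn_integral_quiet_step:
  assumes B: "B \<subseteq> X"
  shows "ennreal (exp (- (sum lam B * max 0 s)))
       \<le> (\<integral>\<^sup>+ y. (if snd y \<in> B \<and> fst y < s then 0
              else ennreal (exp (- (sum lam B * max 0 (s - fst y))))) \<partial>arrival_law)"
proof -
  let ?q = "sum lam B / rate"
  let ?G = "\<lambda>w. if s \<le> w then 1 else ennreal ((1 - ?q) * exp (- (?q * rate * (s - w))))"
  let ?F = "\<lambda>y. if snd y \<in> B \<and> fst y < s then 0
              else ennreal (exp (- (sum lam B * max 0 (s - fst y))))"
  have q: "?q \<le> 1" using sum_lam_le[OF B] rate_pos by simp
  have [measurable]: "Measurable.pred arrival_law (\<lambda>y. snd y \<in> B)"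
    by (rule measurable_compose[OF measurable_arrival_snd]) auto
  have F: "?F \<in> borel_measurable arrival_law" by measurable
  have "(\<Sum>x\<in>X. ennreal (lam x / rate) * ?F (w, x)) = ?G w" for w
  proof (cases "s \<le> w")
    case True
    then show ?thesis using prob_sum lam_nonneg rate_pos by (simp add: max_def sum_ennreal)
  next
    case False
    have "(\<Sum>x\<in>X. ennreal (lam x / rate) * ?F (w, x))
        = (\<Sum>x\<in>X. ennreal (lam x / rate) * (if x \<in> B then 0 else 1)) * ennreal (exp (- (sum lam B * (s - w))))"
      unfolding sum_distrib_right using False by (intro sum.cong) auto
    then show ?thesis
      using False q rate_pos by (simp add: sum_prob_avoiding[OF B] ennreal_mult'[symmetric])
  qed
  then have eq: "(\<integral>\<^sup>+ y. ?F y \<partial>arrival_law) = (\<integral>\<^sup>+ w. ?G w \<partial>waiting)"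
    unfolding nn_integral_arrival_law[OF F] by simp
  show ?thesis
  proof (cases "0 \<le> s")
    case True
    then show ?thesis
      unfolding eq nn_integral_exponential_first_hit[OF rate_pos q True] using rate_pos by simp
  next
    case False
    have "(\<integral>\<^sup>+ w. 1 \<partial>waiting) \<le> (\<integral>\<^sup>+ w. ?G w \<partial>waiting)"
      by (rule nn_integral_mono_AE, use AE_waiting_nonneg in eventually_elim) (use False in auto)
    then show ?thesis unfolding eq using False by (simp add: emeasure_waiting_UNIV)
  qed
qed

text \<open>\<open>R\<close> stands for any weight determined by the history up to request
  \<open>i\<close>, which is what \<open>R_upd\<close> expresses; the arrivals after
  \<open>i\<close> are independent of it. Appending arrivals one at a time never decreases the
  expectation of \<open>?\<Phi>\<close>, by \<open>nn_integral_quiet_step\<close>.\<close>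

lemma nn_integral_quiet_after:
  assumes B: "B \<subseteq> X" and u: "0 \<le> u" and "i < m"
    and R_meas: "\<And>m. i < m \<Longrightarrow> R \<in> borel_measurable (sample_space m)"
    and R_upd: "\<And>\<eta> m y. i < m \<Longrightarrow> R (\<eta>(m := y)) = R \<eta>"
  shows "(\<integral>\<^sup>+ \<eta>. R \<eta> \<partial>(sample_space (Suc i))) * ennreal (exp (- (sum lam B * u)))
       \<le> (\<integral>\<^sup>+ \<eta>. R \<eta> * (if quiet_after B \<eta> i m u then 1 else 0) \<partial>(sample_space m))"
proof -
  let ?Q = "\<lambda>m \<eta>. if quiet_after B \<eta> i m u then 1 else 0 :: ennreal"
  let ?E = "\<lambda>s. ennreal (exp (- (sum lam B * max 0 s)))"
  let ?t = "\<lambda>m \<eta>. \<Sum>k\<in>{i<..<m}. fst (\<eta> k)"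
  let ?\<Phi> = "\<lambda>m \<eta>. R \<eta> * ?Q m \<eta> * ?E (u - ?t m \<eta>)"
  have \<Phi>_meas: "?\<Phi> m \<in> borel_measurable (sample_space m)" if "i < m" for m
  proof -
    have [measurable]: "?t m \<in> borel_measurable (sample_space m)"
      by (intro borel_measurable_sum measurable_wait) auto
    have [measurable]: "?Q m \<in> borel_measurable (sample_space m)"
      using that by (intro measurable_If measurable_quiet_after) auto
    note R_meas[OF that, measurable]
    show ?thesis by measurable
  qed
  \<comment> \<open>\<open>?E s\<close> is the probability that an infinite continuation stays quiet for a further time \<open>s\<close>.\<close>
  have "Suc i \<le> m \<Longrightarrow> (\<integral>\<^sup>+ \<eta>. R \<eta> \<partial>(sample_space (Suc i))) * ?E u \<le> (\<integral>\<^sup>+ \<eta>. ?\<Phi> m \<eta> \<partial>(sample_space m))"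
  proof (induction m rule: dec_induct)
    case base
    have "{i<..<Suc i} = {}" by auto
    then show ?case using R_meas by (simp add: quiet_after_def nn_integral_multc)
  next
    case (step m)
    then have "i < m" by simp
    have "?\<Phi> m \<eta> \<le> (\<integral>\<^sup>+ y. ?\<Phi> (Suc m) (\<eta>(m := y)) \<partial>arrival_law)" for \<eta>
    proof -
      define s where "s = u - ?t m \<eta>"
      let ?F = "\<lambda>y. if snd y \<in> B \<and> fst y < s then 0
              else ennreal (exp (- (sum lam B * max 0 (s - fst y))))"
      have [measurable]: "Measurable.pred arrival_law (\<lambda>y. snd y \<in> B)"
        by (rule measurable_compose[OF measurable_arrival_snd]) auto
      have set_eq: "{i<..<Suc m} = insert m {i<..<m}" "{i<..m} = insert m {i<..<m}"
        using \<open>i < m\<close> by auto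
      have sum_eq: "(\<Sum>k\<in>{i<..j}. fst ((\<eta>(m := y)) k)) = (\<Sum>k\<in>{i<..j}. fst (\<eta> k))" if "j < m" for j y
        using that by (intro sum.cong) auto
      have t: "?t (Suc m) (\<eta>(m := y)) = ?t m \<eta> + fst y"
        and t': "(\<Sum>k\<in>{i<..m}. fst ((\<eta>(m := y)) k)) = ?t m \<eta> + fst y" for y
        by (simp_all add: set_eq)
      have "?\<Phi> m \<eta> \<le> R \<eta> * ?Q m \<eta> * (\<integral>\<^sup>+ y. ?F y \<partial>arrival_law)"
        unfolding s_def[symmetric] by (intro mult_left_mono nn_integral_quiet_step B) auto
      also have "\<dots> = (\<integral>\<^sup>+ y. R \<eta> * ?Q m \<eta> * ?F y \<partial>arrival_law)"
        by (intro nn_integral_cmult[symmetric]) measurable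
      also have "\<dots> \<le> (\<integral>\<^sup>+ y. ?\<Phi> (Suc m) (\<eta>(m := y)) \<partial>arrival_law)"
      proof (rule nn_integral_mono)
        fix y
        have "quiet_after B (\<eta>(m := y)) i (Suc m) u"
          if "quiet_after B \<eta> i m u" "\<not> (snd y \<in> B \<and> fst y < s)"
          unfolding quiet_after_def
        proof (intro ballI impI)
          fix j assume j: "j \<in> {i<..<Suc m}" "snd ((\<eta>(m := y)) j) \<in> B"
          show "u \<le> (\<Sum>k\<in>{i<..j}. fst ((\<eta>(m := y)) k))"
          proof (cases "j = m")
            case True
            then show ?thesis using that(2) j t'[of y] by (auto simp: s_def simp del: fun_upd_apply) (simp add: s_def)
          next
            case False
            then show ?thesis using that(1) j sum_eq[of j y] by (auto simp: quiet_after_def)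
          qed
        qed
        then show "R \<eta> * ?Q m \<eta> * ?F y \<le> ?\<Phi> (Suc m) (\<eta>(m := y))"
          unfolding t R_upd[OF \<open>i < m\<close>] by (auto simp: s_def algebra_simps simp del: fun_upd_apply)
      qed
      finally show ?thesis .
    qed
    then have "(\<integral>\<^sup>+ \<eta>. ?\<Phi> m \<eta> \<partial>(sample_space m)) \<le> (\<integral>\<^sup>+ \<eta>. ?\<Phi> (Suc m) \<eta> \<partial>(sample_space (Suc m)))"
      using \<open>i < m\<close> by (subst nn_integral_poisson_Suc(1)[OF \<Phi>_meas]) (auto intro!: nn_integral_mono simp del: fun_upd_apply)
    with step.IH show ?case by (rule order_trans)
  qed
  \<comment> \<open>Stopping after \<open>m\<close> arrivals can only make the period quieter, so
    the factor for the imagined continuation is bounded by 1.\<close>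
  also have "(\<integral>\<^sup>+ \<eta>. ?\<Phi> m \<eta> \<partial>(sample_space m)) \<le> (\<integral>\<^sup>+ \<eta>. R \<eta> * ?Q m \<eta> * 1 \<partial>(sample_space m))"
  proof (intro nn_integral_mono mult_left_mono)
    show "?E s \<le> 1" for s
      using B lam_nonneg by (auto intro!: mult_nonneg_nonneg sum_nonneg)
  qed simp
  finally show ?thesis using \<open>i < m\<close> u by (simp add: Suc_le_eq max_def)
qed

text \<open>The quiet period before \<open>i\<close> is part of the history, so it serves as the
  weight \<open>R\<close> for the quiet period after \<open>i\<close>. Each side contributes one
  factor \<open>exp (- (sum lam B * u))\<close>.\<close>

lemma nn_integral_quiet:
  assumes B: "B \<subseteq> X" and u: "0 \<le> u" and "i < m"
  shows "(\<Sum>x\<in>X. ennreal (lam x / rate) * h x) * ennreal (exp (- (2 * sum lam B * u)))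
       \<le> (\<integral>\<^sup>+ \<eta>. h (snd (\<eta> i)) * (if quiet_before B \<eta> i u then 1 else 0)
             * (if quiet_after B \<eta> i m u then 1 else 0) \<partial>(sample_space m))"
proof -
  let ?R = "\<lambda>\<eta>. h (snd (\<eta> i)) * (if quiet_before B \<eta> i u then 1 else 0)"
  let ?e = "ennreal (exp (- (sum lam B * u)))"
  have "ennreal (exp (- (2 * sum lam B * u))) = ?e * ?e"
    by (simp add: ennreal_mult'[symmetric] exp_add[symmetric])
  then have "(\<Sum>x\<in>X. ennreal (lam x / rate) * h x) * ennreal (exp (- (2 * sum lam B * u)))
      = (\<Sum>x\<in>X. ennreal (lam x / rate) * h x) * ?e * ?e"
    by (simp add: mult.assoc)
  also have "\<dots> \<le> (\<integral>\<^sup>+ \<eta>. ?R \<eta> \<partial>(sample_space (Suc i))) * ?e"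
    by (intro mult_right_mono nn_integral_quiet_before B u) auto
  also have "\<dots> \<le> (\<integral>\<^sup>+ \<eta>. ?R \<eta> * (if quiet_after B \<eta> i m u then 1 else 0) \<partial>(sample_space m))"
  proof (rule nn_integral_quiet_after[OF B u \<open>i < m\<close>])
    show "?R \<in> borel_measurable (sample_space n)" if "i < n" for n
      using that
      by (auto intro!: borel_measurable_times_ennreal measurable_fun_of_site measurable_If measurable_quiet_before)
    show "?R (\<eta>(n := y)) = ?R \<eta>" if "i < n" for \<eta> n y
    proof -
      have "(\<Sum>k\<in>{j<..i}. fst ((\<eta>(n := y)) k)) = (\<Sum>k\<in>{j<..i}. fst (\<eta> k))" for j
        using that by (intro sum.cong) auto
      then show ?thesis using that by (auto simp: quiet_before_def)
    qed
  qed
  finally show ?thesis .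
qed

end

section \<open>Radii and the Radius algorithm\<close>

locale mpmd_metric = poisson_arrivals X lam + Metric_space X d
  for X :: "'a set" and lam :: "'a \<Rightarrow> real" and d :: "'a \<Rightarrow> 'a \<Rightarrow> real"
begin

abbreviation "\<rho> \<equiv> radius X d lam"

section \<open>Existence and minimality of the radius\<close>

lemma sum_lam_pos: "x \<in> B \<Longrightarrow> B \<subseteq> X \<Longrightarrow> 0 < sum lam B"
  using finite_X finite_subset lam_pos by (intro sum_pos) auto

text \<open>\<open>LEAST\<close> on the reals has the expected meaning only if a minimum is
  attained, so one has to be exhibited.\<close>

lemma radius_least:
  assumes x: "x \<in> X"
  shows "0 \<le> \<rho> x \<and> 1 / sum lam (mcball x (\<rho> x)) \<le> \<rho> x"
    and "0 \<le> u \<Longrightarrow> 1 / sum lam (mcball x u) \<le> u \<Longrightarrow> \<rho> x \<le> u"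
proof -
  let ?P = "\<lambda>u. 0 \<le> u \<and> 1 / sum lam (mcball x u) \<le> u"
  \<comment> \<open>The ball only changes at distances from \<open>x\<close>, so the minimum runs over finitely many values.\<close>
  define c where "c v = max v (1 / sum lam (mcball x v))" for v
  \<comment> \<open>\<open>c v\<close> is the least \<open>u \<ge> v\<close> that satisfies the
    condition with the rate of the ball of radius \<open>v\<close>; growing that ball to radius
    \<open>c v\<close> only increases its rate.\<close>
  define r where "r = Min (c ` d x ` X)"
  have r_in: "r \<in> c ` d x ` X"
    unfolding r_def using finite_X x by (intro Min_in) auto
  then obtain y where y: "y \<in> X" "r = c (d x y)" by auto
  have "d x y \<le> r" "1 / sum lam (mcball x (d x y)) \<le> r"
    using y by (auto simp: c_def)
  moreover have "sum lam (mcball x (d x y)) \<le> sum lam (mcball x r)"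
    using finite_X \<open>d x y \<le> r\<close> lam_nonneg
    by (intro sum_mono2 mcball_subset_concentric finite_subset[OF mcball_subset_mspace]) auto
  moreover have "0 < sum lam (mcball x (d x y))"
    using x by (intro sum_lam_pos) auto
  ultimately have "1 / sum lam (mcball x r) \<le> r"
    by (meson divide_left_mono less_le_trans mult_pos_pos order_trans zero_le_one)
  moreover have "0 \<le> r"
    using \<open>d x y \<le> r\<close> nonneg order_trans by blast
  ultimately have r: "?P r" by simp
  have least: "r \<le> u" if "?P u" for u
  proof -
    \<comment> \<open>Rounding \<open>u\<close> down to the largest distance not above it leaves the
      ball unchanged; \<open>d x x\<close> keeps the set nonempty.\<close>
    let ?V = "{v \<in> d x ` X. v \<le> u}"
    have V: "finite ?V" "d x x \<in> ?V"
      using finite_X that imageI[OF x, of "d x"] mdist_zero[OF x] by auto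
    have "mcball x (Max ?V) = mcball x u"
    proof -
      have "Max ?V \<in> ?V" using V by (intro Max_in) auto
      moreover have "d x z \<le> Max ?V" if "z \<in> X" "d x z \<le> u" for z
        using that V by (intro Max_ge) auto
      ultimately show ?thesis by auto
    qed
    moreover have Vin: "Max ?V \<in> ?V" using V by (intro Max_in) auto
    ultimately have "c (Max ?V) \<le> u" using that by (auto simp: c_def)
    moreover have "r \<le> c (Max ?V)"
      unfolding r_def using finite_X Vin by (intro Min_le) auto
    ultimately show ?thesis by simp
  qed
  have "\<rho> x = r"
    unfolding radius_def using r least by (intro Least_equality) auto
  with r least show "?P (\<rho> x)" "0 \<le> u \<Longrightarrow> 1 / sum lam (mcball x u) \<le> u \<Longrightarrow> \<rho> x \<le> u"
    by auto
qed

lemma radius_pos: "x \<in> X \<Longrightarrow> 0 < \<rho> x"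
  using radius_least(1)[of x] sum_lam_pos[of x "mcball x (\<rho> x)"]
  by (smt (verit) centre_in_mcball_iff divide_pos_pos mcball_subset_mspace)

text \<open>If the open ball had rate above \<open>1 / \<rho> x\<close>, a radius \<open>u\<close>
  slightly below \<open>\<rho> x\<close> would already qualify: the larger of
  \<open>1 / ?\<mu>\<close> and all distances below \<open>\<rho> x\<close>, whose closed ball is
  the same set. This contradicts minimality.\<close>

lemma radius_open_ball:
  assumes x: "x \<in> X"
  shows "sum lam (mball x (\<rho> x)) * \<rho> x \<le> 1"
proof (rule ccontr)
  let ?\<mu> = "sum lam (mball x (\<rho> x))"
  assume "\<not> ?\<mu> * \<rho> x \<le> 1"
  have \<mu>: "0 < ?\<mu>" using x radius_pos by (intro sum_lam_pos) auto
  with \<open>\<not> ?\<mu> * \<rho> x \<le> 1\<close> have lt: "1 / ?\<mu> < \<rho> x" by (simp add: field_simps)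
  let ?V = "insert (1 / ?\<mu>) {v \<in> d x ` X. v < \<rho> x}"
  define u where "u = Max ?V"
  have fin: "finite ?V" using finite_X by auto
  have u: "u < \<rho> x" unfolding u_def using fin lt by (subst Max_less_iff) auto
  have u': "1 / ?\<mu> \<le> u" unfolding u_def using fin by (intro Max_ge) auto
  have "mcball x u = mball x (\<rho> x)"
  proof -
    have "d x z \<le> u" if "z \<in> X" "d x z < \<rho> x" for z
      unfolding u_def using that fin by (intro Max_ge) auto
    then show ?thesis using u by auto
  qed
  then have "1 / sum lam (mcball x u) \<le> u" using u' by simp
  moreover have "0 \<le> u" using u' \<mu> by (smt (verit) divide_nonneg_pos)
  ultimately have "\<rho> x \<le> u" using radius_least(2)[OF x] by blast
  with u show False by simp
qed

section \<open>Invariant of the Radius algorithm and a pathwise cost bound\<close>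

text \<open>Parity makes the final rule applicable, separation limits what is left at the end, and
  the sum charges each matched pair to the radii of its two members. The last two clauses say that
  nobody waits beyond the first hit of the own ball; \<open>k\<close> is outside the interval
  because that hit itself may be the matching time.\<close>

definition radius_inv :: "'a request list \<Rightarrow> nat \<Rightarrow> nat set \<times> (nat \<times> nat) set \<times> (nat \<Rightarrow> real) \<Rightarrow> bool" where
  "radius_inv \<sigma> i = (\<lambda>(P, M, s).
     P \<subseteq> {..<i} \<and> even (i + card P) \<and> M \<subseteq> {..<i} \<times> {..<i} \<and>
     (\<forall>j\<in>P. \<forall>k\<in>P. j \<noteq> k \<longrightarrow> \<rho> (loc \<sigma> j) + \<rho> (loc \<sigma> k) < d (loc \<sigma> j) (loc \<sigma> k)) \<and>
     (\<Sum>(j, k)\<in>M. d (loc \<sigma> j) (loc \<sigma> k)) \<le> (\<Sum>j\<in>{..<i} - P. \<rho> (loc \<sigma> j)) \<and>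
     (\<forall>j\<in>P. \<forall>l\<in>{j<..<i}. \<rho> (loc \<sigma> j) < d (loc \<sigma> j) (loc \<sigma> l)) \<and>
     (\<forall>j\<in>{..<i} - P. \<exists>k. j \<le> k \<and> k < i \<and> s j = arrival \<sigma> k \<and>
        (\<forall>l\<in>{j<..<k}. \<rho> (loc \<sigma> j) < d (loc \<sigma> j) (loc \<sigma> l))))"

lemma radius_invI:
  assumes "P \<subseteq> {..<i}" and "even (i + card P)" and "M \<subseteq> {..<i} \<times> {..<i}"
    and "\<And>j k. j \<in> P \<Longrightarrow> k \<in> P \<Longrightarrow> j \<noteq> k \<Longrightarrow> \<rho> (loc \<sigma> j) + \<rho> (loc \<sigma> k) < d (loc \<sigma> j) (loc \<sigma> k)"
    and "(\<Sum>(j, k)\<in>M. d (loc \<sigma> j) (loc \<sigma> k)) \<le> (\<Sum>j\<in>{..<i} - P. \<rho> (loc \<sigma> j))"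
    and "\<And>j l. j \<in> P \<Longrightarrow> l \<in> {j<..<i} \<Longrightarrow> \<rho> (loc \<sigma> j) < d (loc \<sigma> j) (loc \<sigma> l)"
    and "\<And>j. j \<in> {..<i} - P \<Longrightarrow> \<exists>k. j \<le> k \<and> k < i \<and> s j = arrival \<sigma> k \<and>
        (\<forall>l\<in>{j<..<k}. \<rho> (loc \<sigma> j) < d (loc \<sigma> j) (loc \<sigma> l))"
  shows "radius_inv \<sigma> i (P, M, s)"
  unfolding radius_inv_def case_prod_conv by (intro conjI ballI impI assms)

text \<open>When the new request becomes pending, emptiness of \<open>C1\<close> preserves the
  no-hit clause and emptiness of \<open>C2\<close> preserves separation. When it is matched,
  membership in \<open>C2\<close> pays for the pair.\<close>

lemma radius_inv_step:
  assumes tie: "tie_rule tie" and inv: "radius_inv \<sigma> i (P, M, s)"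
    and locs: "\<And>j. j \<le> i \<Longrightarrow> loc \<sigma> j \<in> X"
  shows "radius_inv \<sigma> (Suc i) (radius_step d \<rho> tie \<sigma> i (P, M, s))"
proof -
  define C1 where "C1 = {j \<in> P. d (loc \<sigma> i) (loc \<sigma> j) \<le> \<rho> (loc \<sigma> j)}"
  define C2 where "C2 = {j \<in> P. d (loc \<sigma> i) (loc \<sigma> j) \<le> \<rho> (loc \<sigma> j) + \<rho> (loc \<sigma> i)}"
  define C where "C = (if C1 \<noteq> {} then C1 else C2)"
  define j where "j = tie (take (Suc i) \<sigma>) C"
  have step: "radius_step d \<rho> tie \<sigma> i (P, M, s) = (if C = {} then (insert i P, M, s)
        else (P - {j}, insert (j, i) M, s(i := arrival \<sigma> i, j := arrival \<sigma> i)))"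
    by (simp only: radius_step_def Let_def case_prod_conv C1_def C2_def C_def j_def)
  have P: "P \<subseteq> {..<i}" "finite P" and ev: "even (i + card P)" and M: "M \<subseteq> {..<i} \<times> {..<i}"
    and sep: "\<And>j k. j \<in> P \<Longrightarrow> k \<in> P \<Longrightarrow> j \<noteq> k \<Longrightarrow> \<rho> (loc \<sigma> j) + \<rho> (loc \<sigma> k) < d (loc \<sigma> j) (loc \<sigma> k)"
    and cost: "(\<Sum>(j, k)\<in>M. d (loc \<sigma> j) (loc \<sigma> k)) \<le> (\<Sum>j\<in>{..<i} - P. \<rho> (loc \<sigma> j))"
    and unhit: "\<And>j l. j \<in> P \<Longrightarrow> j < l \<Longrightarrow> l < i \<Longrightarrow> \<rho> (loc \<sigma> j) < d (loc \<sigma> j) (loc \<sigma> l)"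
    and matched: "\<And>j. j < i \<Longrightarrow> j \<notin> P \<Longrightarrow> \<exists>k. j \<le> k \<and> k < i \<and> s j = arrival \<sigma> k \<and>
        (\<forall>l\<in>{j<..<k}. \<rho> (loc \<sigma> j) < d (loc \<sigma> j) (loc \<sigma> l))"
    using inv finite_subset[of P "{..<i}"] by (auto simp: radius_inv_def)
  have i_notin: "i \<notin> P" using P by auto
  show ?thesis
  proof (cases "C = {}")
    case True
    then have C: "C1 = {}" "C2 = {}" by (auto simp: C_def split: if_splits)
    have 1: "\<rho> (loc \<sigma> j) + \<rho> (loc \<sigma> k) < d (loc \<sigma> j) (loc \<sigma> k)"
      if "j \<in> insert i P" "k \<in> insert i P" "j \<noteq> k" for j k
      using that sep[of j k] C(2) commute[of "loc \<sigma> i" "loc \<sigma> j"] unfolding C2_def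
      by (smt (verit) empty_Collect_eq insert_iff)
    have 2: "\<rho> (loc \<sigma> j) < d (loc \<sigma> j) (loc \<sigma> l)" if "j \<in> insert i P" "l \<in> {j<..<Suc i}" for j l
      using that unhit[of j l] C(1) commute[of "loc \<sigma> i" "loc \<sigma> j"] unfolding C1_def
      by (cases "l = i") (auto simp: not_le)
    have 3: "\<exists>k. j \<le> k \<and> k < Suc i \<and> s j = arrival \<sigma> k \<and>
        (\<forall>l\<in>{j<..<k}. \<rho> (loc \<sigma> j) < d (loc \<sigma> j) (loc \<sigma> l))" if "j \<in> {..<Suc i} - insert i P" for j
    proof -
      have "j < i" "j \<notin> P" using that by auto
      from matched[OF this] show ?thesis using less_SucI by blast
    qed
    have 4: "{..<Suc i} - insert i P = {..<i} - P" by auto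
    have 5: "even (Suc i + card (insert i P))" using ev P i_notin by simp
    have 6: "insert i P \<subseteq> {..<Suc i}" "M \<subseteq> {..<Suc i} \<times> {..<Suc i}" using P M by auto
    have 7: "(\<Sum>(j, k)\<in>M. d (loc \<sigma> j) (loc \<sigma> k)) \<le> (\<Sum>j\<in>{..<Suc i} - insert i P. \<rho> (loc \<sigma> j))"
      unfolding 4 by (rule cost)
    show ?thesis
      unfolding step if_P[OF True] by (intro radius_invI 1 2 3 5 6 7)
  next
    case False
    have "finite C" using P by (auto simp: C_def C1_def C2_def)
    with False have jC: "j \<in> C" using tie by (auto simp: j_def tie_rule_def)
    have C_sub: "C \<subseteq> C2"
      using radius_pos[OF locs[of i]] by (auto simp: C_def C1_def C2_def)
    with jC have jP: "j \<in> P" and dj: "d (loc \<sigma> j) (loc \<sigma> i) \<le> \<rho> (loc \<sigma> j) + \<rho> (loc \<sigma> i)"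
      by (auto simp: C2_def commute)
    have ji: "j < i" using jP P by auto
    \<comment> \<open>The balls of pending requests are disjoint, so at most one of them contains the new request.\<close>
    have miss: "\<rho> (loc \<sigma> k) < d (loc \<sigma> k) (loc \<sigma> i)" if k: "k \<in> P - {j}" for k
    proof (rule ccontr)
      assume "\<not> ?thesis"
      then have k1: "k \<in> C1" using k by (auto simp: C1_def commute)
      \<comment> \<open>Here the priority of the first rule enters: as \<open>C1\<close> is
        nonempty, the partner \<open>j\<close> was taken from it.\<close>
      then have "j \<in> C1" using jC unfolding C_def by (metis empty_iff)
      then have "d (loc \<sigma> j) (loc \<sigma> k) \<le> \<rho> (loc \<sigma> j) + \<rho> (loc \<sigma> k)"
        using k1 triangle[of "loc \<sigma> j" "loc \<sigma> i" "loc \<sigma> k"] locs[of j] locs[of k] locs[of i] ji k P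
        by (auto simp: C1_def commute)
      then show False using sep[of j k] k jP by auto
    qed
    have 1: "(\<Sum>(j, k)\<in>insert (j, i) M. d (loc \<sigma> j) (loc \<sigma> k)) \<le> (\<Sum>k\<in>{..<Suc i} - (P - {j}). \<rho> (loc \<sigma> k))"
    proof -
      have "finite M" using M finite_subset by blast
      moreover have "(j, i) \<notin> M" using M by auto
      moreover have "{..<Suc i} - (P - {j}) = insert i (insert j ({..<i} - P))" using ji i_notin by auto
      ultimately show ?thesis using cost dj ji jP by simp
    qed
    have 2: "\<exists>k'. k \<le> k' \<and> k' < Suc i \<and> (s(i := arrival \<sigma> i, j := arrival \<sigma> i)) k = arrival \<sigma> k' \<and>
        (\<forall>l\<in>{k<..<k'}. \<rho> (loc \<sigma> k) < d (loc \<sigma> k) (loc \<sigma> l))" if k: "k \<in> {..<Suc i} - (P - {j})" for k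
    proof (cases "k = i \<or> k = j")
      case True
      then show ?thesis using unhit[OF jP] ji by (intro exI[of _ i]) auto
    next
      case False
      then have "k < i" "k \<notin> P" using k by auto
      from matched[OF this] obtain k' where k': "k \<le> k'" "k' < i" "s k = arrival \<sigma> k'"
        "\<forall>l\<in>{k<..<k'}. \<rho> (loc \<sigma> k) < d (loc \<sigma> k) (loc \<sigma> l)" by blast
      show ?thesis using k' False by (intro exI[of _ k']) simp
    qed
    have 3: "\<rho> (loc \<sigma> k) < d (loc \<sigma> k) (loc \<sigma> l)" if "k \<in> P - {j}" "l \<in> {k<..<Suc i}" for k l
      using that unhit[of k l] miss[of k] by (cases "l = i") auto
    have 4: "even (Suc i + card (P - {j}))"
    proof -
      have "card P = Suc (card (P - {j}))" using card_Suc_Diff1[OF P(2) jP] by simp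
      with ev show ?thesis by simp
    qed
    have 5: "insert (j, i) M \<subseteq> {..<Suc i} \<times> {..<Suc i}" using M ji by fastforce
    have 6: "P - {j} \<subseteq> {..<Suc i}" using P by auto
    show ?thesis
      unfolding step if_not_P[OF False] by (intro radius_invI 1 2 3 4 5 6 sep) auto
  qed
qed

lemma radius_inv_fold:
  assumes "tie_rule tie" and "\<And>j. j < i \<Longrightarrow> loc \<sigma> j \<in> X"
  shows "radius_inv \<sigma> i (fold (radius_step d \<rho> tie \<sigma>) [0..<i] ({}, {}, \<lambda>_. 0))"
  using assms(2)
proof (induction i)
  case 0
  show ?case by (simp add: radius_inv_def)
next
  case (Suc i)
  obtain P M s where st: "fold (radius_step d \<rho> tie \<sigma>) [0..<i] ({}, {}, \<lambda>_. 0) = (P, M, s)"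
    by (metis prod_cases3)
  with Suc have "radius_inv \<sigma> i (P, M, s)" by simp
  from radius_inv_step[OF assms(1) this] Suc.prems show ?case by (simp add: st)
qed

text \<open>\<open>F j\<close> is any bound on the time from \<open>j\<close> to the first later
  request in its ball. Keeping it abstract separates the combinatorics from probability. The sum of
  all distances pays for the final matching.\<close>

lemma radius_cost_le:
  assumes tie: "tie_rule tie" and final: "final_rule fin" and ev: "even (length \<sigma>)"
    and locs: "\<And>j. j < length \<sigma> \<Longrightarrow> loc \<sigma> j \<in> X"
    and F: "\<And>j k. j \<le> k \<Longrightarrow> k < length \<sigma> \<Longrightarrow>
       (\<And>l. j < l \<Longrightarrow> l < k \<Longrightarrow> \<rho> (loc \<sigma> j) < d (loc \<sigma> j) (loc \<sigma> l)) \<Longrightarrow> arrival \<sigma> k - arrival \<sigma> j \<le> F j"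
  shows "radius_cost X d lam tie fin \<sigma>
     \<le> (\<Sum>j<length \<sigma>. \<rho> (loc \<sigma> j)) + (\<Sum>(x, y)\<in>X \<times> X. d x y) + (\<Sum>j<length \<sigma>. F j)"
proof -
  let ?m = "length \<sigma>"
  obtain P M s where st: "fold (radius_step d \<rho> tie \<sigma>) [0..<?m] ({}, {}, \<lambda>_. 0) = (P, M, s)"
    by (metis prod_cases3)
  have inv: "radius_inv \<sigma> ?m (P, M, s)"
    using radius_inv_fold[OF tie, of ?m \<sigma>] locs by (simp add: st)
  then have P: "P \<subseteq> {..<?m}" "finite P" and evP: "even (card P)" and M: "M \<subseteq> {..<?m} \<times> {..<?m}"
    and sep: "\<And>j k. j \<in> P \<Longrightarrow> k \<in> P \<Longrightarrow> j \<noteq> k \<Longrightarrow> \<rho> (loc \<sigma> j) + \<rho> (loc \<sigma> k) < d (loc \<sigma> j) (loc \<sigma> k)"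
    and cost: "(\<Sum>(j, k)\<in>M. d (loc \<sigma> j) (loc \<sigma> k)) \<le> (\<Sum>j\<in>{..<?m} - P. \<rho> (loc \<sigma> j))"
    and unhit: "\<And>j l. j \<in> P \<Longrightarrow> j < l \<Longrightarrow> l < ?m \<Longrightarrow> \<rho> (loc \<sigma> j) < d (loc \<sigma> j) (loc \<sigma> l)"
    and matched: "\<And>j. j < ?m \<Longrightarrow> j \<notin> P \<Longrightarrow> \<exists>k. j \<le> k \<and> k < ?m \<and> s j = arrival \<sigma> k \<and>
        (\<forall>l\<in>{j<..<k}. \<rho> (loc \<sigma> j) < d (loc \<sigma> j) (loc \<sigma> l))"
    using finite_subset[of P "{..<?m}"] ev by (auto simp: radius_inv_def)
  have locsP: "loc \<sigma> j \<in> X" if "j \<in> P" for j using that P locs by auto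
  let ?N = "fin \<sigma> P"
  have "perfect_matching P ?N" using final P evP by (simp add: final_rule_def)
  then have N: "?N \<subseteq> P \<times> P" by (auto simp: perfect_matching_def)
  have finM: "finite M" using M finite_subset by blast
  have finN: "finite ?N" using N P finite_subset by blast
  let ?s = "\<lambda>i. if i \<in> P then arrival \<sigma> (?m - 1) else s i"
  have "radius_cost X d lam tie fin \<sigma> = mpmd_cost d \<sigma> (M \<union> ?N) ?s"
    by (simp add: radius_cost_def radius_algorithm_def st radius_finish_def)
  also have "\<dots> \<le> ((\<Sum>j<?m. \<rho> (loc \<sigma> j)) + (\<Sum>(x, y)\<in>X \<times> X. d x y)) + (\<Sum>j<?m. F j)"
    unfolding mpmd_cost_def
  proof (rule add_mono)
    have "(\<Sum>(j, k)\<in>M \<union> ?N. d (loc \<sigma> j) (loc \<sigma> k))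
        \<le> (\<Sum>(j, k)\<in>M. d (loc \<sigma> j) (loc \<sigma> k)) + (\<Sum>(j, k)\<in>?N. d (loc \<sigma> j) (loc \<sigma> k))"
    proof -
      \<comment> \<open>Distances are nonnegative, so an overlap of the two sets of pairs could only
        lower the left side.\<close>
      have "0 \<le> (\<Sum>(j, k)\<in>M \<inter> ?N. d (loc \<sigma> j) (loc \<sigma> k))" by (intro sum_nonneg) auto
      then show ?thesis using sum.union_inter[OF finM finN, of "\<lambda>(j, k). d (loc \<sigma> j) (loc \<sigma> k)"] by simp
    qed
    also have "\<dots> \<le> (\<Sum>j<?m. \<rho> (loc \<sigma> j)) + (\<Sum>(x, y)\<in>X \<times> X. d x y)"
    proof (rule add_mono)
      have "(\<Sum>j\<in>{..<?m} - P. \<rho> (loc \<sigma> j)) \<le> (\<Sum>j<?m. \<rho> (loc \<sigma> j))"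
        using locs radius_pos by (intro sum_mono2) (auto intro: less_imp_le)
      with cost show "(\<Sum>(j, k)\<in>M. d (loc \<sigma> j) (loc \<sigma> k)) \<le> (\<Sum>j<?m. \<rho> (loc \<sigma> j))" by simp
      \<comment> \<open>Separation by positive radii forbids two leftover requests at one point, so
        there are at most \<open>card X\<close> of them, however long the sequence is.\<close>
      have inj: "inj_on (loc \<sigma>) P"
      proof (rule inj_onI, rule ccontr)
        fix j k assume jk: "j \<in> P" "k \<in> P" "loc \<sigma> j = loc \<sigma> k" "j \<noteq> k"
        then show False
          using sep[of j k] radius_pos[OF locsP[of j]] locsP[of j] locsP[of k] zero[of "loc \<sigma> j" "loc \<sigma> k"] by auto
      qed
      have "(\<Sum>(j, k)\<in>?N. d (loc \<sigma> j) (loc \<sigma> k)) \<le> (\<Sum>(j, k)\<in>P \<times> P. d (loc \<sigma> j) (loc \<sigma> k))"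
        using N P by (intro sum_mono2) auto
      also have "\<dots> = (\<Sum>(x, y)\<in>map_prod (loc \<sigma>) (loc \<sigma>) ` (P \<times> P). d x y)"
        using inj by (subst sum.reindex) (auto intro: map_prod_inj_on simp: case_prod_unfold)
      also have "\<dots> \<le> (\<Sum>(x, y)\<in>X \<times> X. d x y)"
        using finite_X locsP by (intro sum_mono2) auto
      finally show "(\<Sum>(j, k)\<in>?N. d (loc \<sigma> j) (loc \<sigma> k)) \<le> (\<Sum>(x, y)\<in>X \<times> X. d x y)" .
    qed
    finally show "(\<Sum>(j, k)\<in>M \<union> ?N. d (loc \<sigma> j) (loc \<sigma> k))
        \<le> (\<Sum>j<?m. \<rho> (loc \<sigma> j)) + (\<Sum>(x, y)\<in>X \<times> X. d x y)" .
    show "(\<Sum>j<?m. ?s j - arrival \<sigma> j) \<le> (\<Sum>j<?m. F j)"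
    proof (rule sum_mono)
      fix j assume "j \<in> {..<?m}"
      then have j: "j < ?m" by simp
      show "?s j - arrival \<sigma> j \<le> F j"
      proof (cases "j \<in> P")
        case True
        \<comment> \<open>Leftover requests wait until the last arrival, whose index is
          \<open>?m - 1\<close>.\<close>
        then show ?thesis using F[of j "?m - 1"] j unhit[of j] by auto
      next
        case False
        then show ?thesis using matched[OF j False] F[of j] by auto
      qed
    qed
  qed
  finally show ?thesis .
qed

end

section \<open>Bounds on the expected costs\<close>

lemma perfect_matching_sum:
  fixes g :: "nat \<Rightarrow> real"
  assumes pm: "perfect_matching V M" and "finite V"
  shows "(\<Sum>(i, j)\<in>M. g i + g j) = sum g V"
proof -
  have sub: "M \<subseteq> {(i, j). i \<in> V \<and> j \<in> V \<and> i < j}"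
    and uniq: "\<And>k. k \<in> V \<Longrightarrow> \<exists>!e. e \<in> M \<and> (k = fst e \<or> k = snd e)"
    using pm by (auto simp: perfect_matching_def)
  have "finite M"
    using sub \<open>finite V\<close> by (intro finite_subset[of M "V \<times> V"]) auto
  have "(\<Union>e\<in>M. {fst e, snd e}) = V"
  proof
    show "(\<Union>e\<in>M. {fst e, snd e}) \<subseteq> V" using sub by auto
    show "V \<subseteq> (\<Union>e\<in>M. {fst e, snd e})" using uniq by blast
  qed
  moreover have "{fst e, snd e} \<inter> {fst e', snd e'} = {}" if "e \<in> M" "e' \<in> M" "e \<noteq> e'" for e e'
  proof (rule ccontr)
    assume "\<not> ?thesis"
    then obtain k where k: "k \<in> {fst e, snd e}" "k \<in> {fst e', snd e'}" by blast
    then have "k \<in> V" using sub that by auto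
    then show False using uniq[of k] k that by auto
  qed
  ultimately have "sum g V = (\<Sum>e\<in>M. sum g {fst e, snd e})"
    using \<open>finite M\<close> sum.UNION_disjoint[of M "\<lambda>e. {fst e, snd e}" g] by auto
  also have "\<dots> = (\<Sum>(i, j)\<in>M. g i + g j)"
    using sub by (intro sum.cong) auto
  finally show ?thesis by simp
qed

text \<open>\<open>Inf\<close> of an empty set of reals carries no information, so
  \<open>mpmd_OPT\<close> needs a feasible solution: neighbours are paired, all at one time that
  exceeds every arrival.\<close>

lemma mpmd_solution_exists:
  assumes "even (length \<sigma>)"
  shows "\<exists>M s. mpmd_solution \<sigma> M s"
proof -
  let ?m = "length \<sigma>"
  let ?M = "(\<lambda>i. (2 * i, 2 * i + 1)) ` {..<?m div 2}"
  let ?c = "\<Sum>i<?m. \<bar>arrival \<sigma> i\<bar>"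
  have "arrival \<sigma> i \<le> ?c" if "i < ?m" for i
  proof -
    have "\<bar>arrival \<sigma> i\<bar> \<le> ?c" using that by (intro member_le_sum) auto
    then show ?thesis by simp
  qed
  moreover have "perfect_matching {..<?m} ?M"
    unfolding perfect_matching_def
  proof (intro conjI ballI)
    show "?M \<subseteq> {(i, j). i \<in> {..<?m} \<and> j \<in> {..<?m} \<and> i < j}" using assms by auto
    fix k assume "k \<in> {..<?m}"
    then have k: "k div 2 < ?m div 2" using assms by (auto elim!: evenE)
    show "\<exists>!e. e \<in> ?M \<and> (k = fst e \<or> k = snd e)"
    proof (rule ex1I[of _ "(2 * (k div 2), 2 * (k div 2) + 1)"])
      have "k = 2 * (k div 2) \<or> k = 2 * (k div 2) + 1" by presburger
      then show "(2 * (k div 2), 2 * (k div 2) + 1) \<in> ?M \<and>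
        (k = fst (2 * (k div 2), 2 * (k div 2) + 1) \<or> k = snd (2 * (k div 2), 2 * (k div 2) + 1))"
        using k by simp
    qed auto
  qed
  ultimately have "mpmd_solution \<sigma> ?M (\<lambda>_. ?c)" by (auto simp: mpmd_solution_def)
  then show ?thesis by blast
qed

text \<open>The common matching time of a pair is at least both arrivals, so the two delays add up
  to at least their difference. The pair thus pays at least \<open>z i\<close> and at least
  \<open>z j\<close>, hence their average; this is the source of the factor 1/2.\<close>

lemma mpmd_OPT_ge:
  assumes ev: "even (length \<sigma>)" and comm: "\<And>x y. d x y = d y x"
    and z: "\<And>i j. i < length \<sigma> \<Longrightarrow> j < length \<sigma> \<Longrightarrow> i \<noteq> j \<Longrightarrow>
       z i \<le> d (loc \<sigma> i) (loc \<sigma> j) + \<bar>arrival \<sigma> i - arrival \<sigma> j\<bar>"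
  shows "(\<Sum>i<length \<sigma>. z i) / 2 \<le> mpmd_OPT d \<sigma>"
  unfolding mpmd_OPT_def
proof (rule cInf_greatest)
  show "{mpmd_cost d \<sigma> M s |M s. mpmd_solution \<sigma> M s} \<noteq> {}"
    using mpmd_solution_exists[OF ev] by auto
  fix c assume "c \<in> {mpmd_cost d \<sigma> M s |M s. mpmd_solution \<sigma> M s}"
  then obtain M s where c: "c = mpmd_cost d \<sigma> M s" and sol: "mpmd_solution \<sigma> M s" by auto
  then have pm: "perfect_matching {..<length \<sigma>} M"
    and s: "\<And>i. i < length \<sigma> \<Longrightarrow> arrival \<sigma> i \<le> s i" "\<And>i j. (i, j) \<in> M \<Longrightarrow> s i = s j"
    by (auto simp: mpmd_solution_def)
  have "(\<Sum>i<length \<sigma>. z i) / 2 = (\<Sum>(i, j)\<in>M. (z i + z j) / 2)"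
    using perfect_matching_sum[OF pm, of z] by (simp add: sum_divide_distrib[symmetric] case_prod_unfold)
  also have "\<dots> \<le> (\<Sum>(i, j)\<in>M. d (loc \<sigma> i) (loc \<sigma> j) + ((s i - arrival \<sigma> i) + (s j - arrival \<sigma> j)))"
  proof (rule sum_mono, clarify)
    fix i j assume ij: "(i, j) \<in> M"
    then have "i < length \<sigma>" "j < length \<sigma>" "i \<noteq> j" using pm by (auto simp: perfect_matching_def)
    then show "(z i + z j) / 2 \<le> d (loc \<sigma> i) (loc \<sigma> j) + ((s i - arrival \<sigma> i) + (s j - arrival \<sigma> j))"
      using z[of i j] z[of j i] s(1)[of i] s(1)[of j] s(2)[OF ij] comm[of "loc \<sigma> i" "loc \<sigma> j"]
      by (auto simp: abs_if split: if_splits)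
  qed
  also have "\<dots> = c"
    using perfect_matching_sum[OF pm, of "\<lambda>i. s i - arrival \<sigma> i"]
    by (simp add: c mpmd_cost_def sum.distrib case_prod_unfold)
  finally show "(\<Sum>i<length \<sigma>. z i) / 2 \<le> c" .
qed

section \<open>Request sequences read off a sample point\<close>

lemma length_poisson_requests [simp]: "length (poisson_requests m \<eta>) = m"
  by (simp add: poisson_requests_def)

lemma loc_poisson_requests: "i < m \<Longrightarrow> loc (poisson_requests m \<eta>) i = snd (\<eta> i)"
  by (simp add: poisson_requests_def)

lemma arrival_poisson_requests_diff:
  assumes "j \<le> i" "i < m"
  shows "arrival (poisson_requests m \<eta>) i - arrival (poisson_requests m \<eta>) j = (\<Sum>k\<in>{j<..i}. fst (\<eta> k))"
proof -
  have "{..i} = {..j} \<union> {j<..i}" using assms by auto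
  then have "(\<Sum>k\<le>i. fst (\<eta> k)) = (\<Sum>k\<le>j. fst (\<eta> k)) + (\<Sum>k\<in>{j<..i}. fst (\<eta> k))"
    by (simp add: sum.union_disjoint ivl_disj_int)
  then show ?thesis using assms by (simp add: poisson_requests_def)
qed

text \<open>The origin of \<open>1 - exp (- 2)\<close>: with \<open>\<mu>\<close> replaced by its
  bound \<open>1 / r\<close> the integrand is \<open>exp (- 2 * u / r)\<close>, and its integral up
  to \<open>r\<close> is the left side.\<close>

lemma exp_integral_ge:
  assumes r: "0 < r" and \<mu>: "\<mu> * r \<le> (1 :: real)"
  shows "ennreal (r * (1 - exp (- 2)) / 2)
       \<le> (\<integral>\<^sup>+ u. indicator {0..r} u * ennreal (exp (- (2 * \<mu> * u))) \<partial>lborel)"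
proof -
  have "ennreal (r * (1 - exp (- 2)) / 2) = ennreal ((- r / 2 * exp (- 2 * r / r)) - (- r / 2 * exp (- 2 * 0 / r)))"
    using r by (simp add: field_simps)
  also have "\<dots> = (\<integral>\<^sup>+ u. ennreal (exp (- 2 * u / r)) * indicator {0..r} u \<partial>lborel)"
    by (rule nn_integral_FTC_Icc[where F="\<lambda>u. - r / 2 * exp (- 2 * u / r)", symmetric])
       (use r in \<open>auto intro!: derivative_eq_intros\<close>)
  also have "\<dots> \<le> (\<integral>\<^sup>+ u. indicator {0..r} u * ennreal (exp (- (2 * \<mu> * u))) \<partial>lborel)"
  proof (rule nn_integral_mono)
    fix u
    have "\<mu> \<le> 1 / r" using r \<mu> by (simp add: field_simps)
    then have "\<mu> * u \<le> 1 / r * u" if "0 \<le> u" using that by (rule mult_right_mono)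
    then show "ennreal (exp (- 2 * u / r)) * indicator {0..r} u \<le> indicator {0..r} u * ennreal (exp (- (2 * \<mu> * u)))"
      by (auto split: split_indicator intro!: ennreal_leI)
  qed
  finally show ?thesis .
qed

context mpmd_metric begin

section \<open>The expected cost of Radius\<close>

definition mean_radius :: real where "mean_radius = (\<Sum>x\<in>X. lam x / rate * \<rho> x)"

lemma mean_radius_pos: "0 < mean_radius"
  unfolding mean_radius_def using finite_X X_ne lam_pos rate_pos radius_pos by (intro sum_pos) auto

lemma ennreal_mean_radius: "(\<Sum>x\<in>X. ennreal (lam x / rate) * ennreal (\<rho> x)) = ennreal mean_radius"
proof -
  have "(\<Sum>x\<in>X. ennreal (lam x / rate) * ennreal (\<rho> x)) = (\<Sum>x\<in>X. ennreal (lam x / rate * \<rho> x))"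
    using lam_nonneg rate_pos by (intro sum.cong ennreal_mult'[symmetric]) auto
  also have "\<dots> = ennreal mean_radius"
    unfolding mean_radius_def
    by (intro sum_ennreal) (simp add: lam_nonneg less_imp_le[OF radius_pos] less_imp_le[OF rate_pos])
  finally show ?thesis .
qed

text \<open>Each request accounts for \<open>mean_radius\<close> twice, once for its share of the
  connection cost and once for its delay.\<close>

lemma expected_radius_cost:
  assumes tie: "tie_rule tie" and final: "final_rule fin" and ev: "even m"
  shows "poisson_expectation X lam m (radius_cost X d lam tie fin)
       \<le> ennreal (2 * real m * mean_radius + (\<Sum>(x, y)\<in>X \<times> X. d x y))"
proof -
  interpret P: prob_space "sample_space m" by (rule prob_space_poisson)
  let ?B = "\<lambda>x. mcball x (\<rho> x)"
  let ?D = "\<Sum>(x, y)\<in>X \<times> X. d x y"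
  let ?U = "\<lambda>\<eta> j. \<Sum>l\<in>{j<..<m}. ennreal (fst (\<eta> l)) * unhit ?B \<eta> j l"
  let ?g = "\<lambda>\<eta>. (\<Sum>j<m. ennreal (\<rho> (snd (\<eta> j)))) + ennreal ?D + (\<Sum>j<m. ?U \<eta> j)"
  have D: "0 \<le> ?D" by (intro sum_nonneg) auto
  have [measurable]: "(\<lambda>\<eta>. ennreal (\<rho> (snd (\<eta> j)))) \<in> borel_measurable (sample_space m)" if "j \<in> {..<m}" for j
    using that measurable_fun_of_site[of j m "\<lambda>x. ennreal (\<rho> x)"] by simp
  have [measurable]: "(\<lambda>\<eta>. ?U \<eta> j) \<in> borel_measurable (sample_space m)" if "j \<in> {..<m}" for j
  proof -
    have [measurable]: "(\<lambda>\<eta>. fst (\<eta> l)) \<in> borel_measurable (sample_space m)"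
      and [measurable]: "(\<lambda>\<eta>. unhit ?B \<eta> j l) \<in> borel_measurable (sample_space m)"
      if "l \<in> {j<..<m}" for l
      using that by auto
    show ?thesis by measurable
  qed
  have "poisson_expectation X lam m (radius_cost X d lam tie fin) \<le> (\<integral>\<^sup>+ \<eta>. ?g \<eta> \<partial>(sample_space m))"
    unfolding poisson_expectation_def
  proof (rule nn_integral_mono_AE, use AE_wait_nonneg[of m] AE_space in eventually_elim)
    case (elim \<eta>)
    let ?\<sigma> = "poisson_requests m \<eta>"
    \<comment> \<open>The real-valued counterpart of \<open>?U\<close>, as
      \<open>radius_cost_le\<close> works over the reals; the two agree where waits are
      nonnegative.\<close>
    define F where "F j = (\<Sum>l\<in>{j<..<m}. if \<forall>k\<in>{j<..<l}. snd (\<eta> k) \<notin> ?B (snd (\<eta> j)) then fst (\<eta> l) else 0)" for j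
    have F_nonneg: "0 \<le> F j" for j
      unfolding F_def using elim by (intro sum_nonneg) auto
    have F_eq: "ennreal (F j) = ?U \<eta> j" for j
    proof -
      have "ennreal (F j) = (\<Sum>l\<in>{j<..<m}. ennreal (if \<forall>k\<in>{j<..<l}. snd (\<eta> k) \<notin> ?B (snd (\<eta> j)) then fst (\<eta> l) else 0))"
        unfolding F_def using elim by (intro sum_ennreal[symmetric]) auto
      also have "\<dots> = ?U \<eta> j"
        by (intro sum.cong) (auto simp: unhit_def)
      finally show ?thesis .
    qed
    have "radius_cost X d lam tie fin ?\<sigma> \<le> (\<Sum>j<length ?\<sigma>. \<rho> (loc ?\<sigma> j)) + ?D + (\<Sum>j<length ?\<sigma>. F j)"
    proof (rule radius_cost_le[OF tie final])
      show "even (length ?\<sigma>)" using ev by simp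
      show "loc ?\<sigma> j \<in> X" if "j < length ?\<sigma>" for j
        using that elim site_in_X by (simp add: loc_poisson_requests)
      fix j k assume jk: "j \<le> k" "k < length ?\<sigma>"
        and miss: "\<And>l. j < l \<Longrightarrow> l < k \<Longrightarrow> \<rho> (loc ?\<sigma> j) < d (loc ?\<sigma> j) (loc ?\<sigma> l)"
      have miss': "\<rho> (snd (\<eta> j)) < d (snd (\<eta> j)) (snd (\<eta> l))" if "j < l" "l < k" for l
        using miss[OF that] jk that by (simp add: loc_poisson_requests)
      have "arrival ?\<sigma> k - arrival ?\<sigma> j = (\<Sum>l\<in>{j<..k}. fst (\<eta> l))"
        using jk by (intro arrival_poisson_requests_diff) auto
      \<comment> \<open>No request strictly between \<open>j\<close> and \<open>k\<close> is a hit,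
        so every condition up to \<open>l = k\<close> holds.\<close>
      also have "\<dots> = (\<Sum>l\<in>{j<..k}. if \<forall>k\<in>{j<..<l}. snd (\<eta> k) \<notin> ?B (snd (\<eta> j)) then fst (\<eta> l) else 0)"
        using miss' by (intro sum.cong) (auto simp: not_le)
      also have "\<dots> \<le> F j"
        unfolding F_def using jk elim by (intro sum_mono2) auto
      finally show "arrival ?\<sigma> k - arrival ?\<sigma> j \<le> F j" .
    qed
    also have "(\<Sum>j<length ?\<sigma>. \<rho> (loc ?\<sigma> j)) = (\<Sum>j<m. \<rho> (snd (\<eta> j)))"
      by (simp add: loc_poisson_requests)
    finally have "ennreal (radius_cost X d lam tie fin ?\<sigma>)
        \<le> ennreal ((\<Sum>j<m. \<rho> (snd (\<eta> j))) + ?D + (\<Sum>j<m. F j))"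
      by (simp add: ennreal_leI)
    also have "\<dots> = ?g \<eta>"
    proof -
      have r: "0 \<le> \<rho> (snd (\<eta> j))" if "j < m" for j
        using that elim site_in_X radius_pos by (auto intro: less_imp_le)
      then have "0 \<le> (\<Sum>j<m. \<rho> (snd (\<eta> j)))" "0 \<le> (\<Sum>j<m. F j)"
        using F_nonneg by (auto intro!: sum_nonneg)
      moreover have "(\<Sum>j<m. ennreal (\<rho> (snd (\<eta> j)))) = ennreal (\<Sum>j<m. \<rho> (snd (\<eta> j)))"
        using r by (intro sum_ennreal) auto
      ultimately show ?thesis
        using D F_nonneg by (simp add: ennreal_plus sum_ennreal F_eq[symmetric])
    qed
    finally show ?case .
  qed
  also have "\<dots> = (\<Sum>j<m. \<integral>\<^sup>+ \<eta>. ennreal (\<rho> (snd (\<eta> j))) \<partial>(sample_space m)) + ennreal ?D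
                  + (\<Sum>j<m. \<integral>\<^sup>+ \<eta>. ?U \<eta> j \<partial>(sample_space m))"
    by (simp add: nn_integral_add nn_integral_sum P.emeasure_space_1)
  also have "\<dots> \<le> (\<Sum>j<m. ennreal mean_radius) + ennreal ?D + (\<Sum>j<m. ennreal mean_radius)"
  proof (intro add_mono sum_mono order_refl)
    fix j assume "j \<in> {..<m}"
    then have j: "j < m" by simp
    show "(\<integral>\<^sup>+ \<eta>. ennreal (\<rho> (snd (\<eta> j))) \<partial>(sample_space m)) \<le> ennreal mean_radius"
      using nn_integral_site[OF j, of "\<lambda>x. ennreal (\<rho> x)"] by (simp add: ennreal_mean_radius)
    have "(\<integral>\<^sup>+ \<eta>. ?U \<eta> j \<partial>(sample_space m))
        \<le> (\<Sum>x\<in>X. ennreal (lam x / rate) * ennreal (1 / sum lam (?B x)))"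
      using radius_pos by (intro expected_unhit_wait j) (auto intro: less_imp_le)
    \<comment> \<open>The defining inequality of the radius turns the mean time to a hit into a
      radius.\<close>
    also have "\<dots> \<le> (\<Sum>x\<in>X. ennreal (lam x / rate) * ennreal (\<rho> x))"
      using radius_least(1) by (intro sum_mono mult_left_mono ennreal_leI) auto
    finally show "(\<integral>\<^sup>+ \<eta>. ?U \<eta> j \<partial>(sample_space m)) \<le> ennreal mean_radius"
      by (simp add: ennreal_mean_radius)
  qed
  also have "\<dots> = ennreal (2 * real m * mean_radius + ?D)"
    using mean_radius_pos D
    by (simp add: ennreal_of_nat_eq_real_of_nat ennreal_mult'[symmetric] ennreal_plus[symmetric] del: ennreal_plus)
  finally show ?thesis .
qed

section \<open>The expected optimum\<close>

text \<open>For nonnegative waits this is the smaller of \<open>\<rho> x\<close> and the time gap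
  from \<open>i\<close> to the nearest other request in the open ball, since the integrand is 1
  exactly for \<open>u\<close> up to that value. Written as an integral, its expectation reduces to
  probabilities of quiet periods.\<close>

definition quiet_time :: "nat \<Rightarrow> (nat \<Rightarrow> real \<times> 'a) \<Rightarrow> nat \<Rightarrow> 'a \<Rightarrow> ennreal" where
  "quiet_time m \<eta> i x = (\<integral>\<^sup>+ u. indicator {0..\<rho> x} u *
     ((if quiet_before (mball x (\<rho> x)) \<eta> i u then 1 else 0) *
      (if quiet_after (mball x (\<rho> x)) \<eta> i m u then 1 else 0)) \<partial>lborel)"

text \<open>Every \<open>u\<close> that contributes is at most \<open>?c\<close>: a request
  \<open>j\<close> outside the open ball is at distance at least \<open>\<rho>\<close>, and one
  inside is separated from \<open>i\<close> in time by at least \<open>u\<close>.\<close>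

lemma quiet_time_le:
  assumes "i < m" "j < m" "i \<noteq> j" and \<eta>: "\<eta> \<in> space (sample_space m)"
  shows "quiet_time m \<eta> i (snd (\<eta> i)) \<le> ennreal (d (snd (\<eta> i)) (snd (\<eta> j))
     + \<bar>arrival (poisson_requests m \<eta>) i - arrival (poisson_requests m \<eta>) j\<bar>)"
    (is "_ \<le> ennreal ?c")
proof -
  let ?x = "snd (\<eta> i)" and ?y = "snd (\<eta> j)"
  let ?B = "mball ?x (\<rho> ?x)"
  have xy: "?x \<in> X" "?y \<in> X" using assms site_in_X by auto
  have "u \<le> ?c" if u: "u \<le> \<rho> ?x" and b: "quiet_before ?B \<eta> i u" and a: "quiet_after ?B \<eta> i m u" for u
  proof (cases "?y \<in> ?B")
    case False
    then show ?thesis using xy u by auto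
  next
    case True
    have "u \<le> \<bar>arrival (poisson_requests m \<eta>) i - arrival (poisson_requests m \<eta>) j\<bar>"
    proof (cases "j < i")
      case True
      then show ?thesis
        using b \<open>?y \<in> ?B\<close> arrival_poisson_requests_diff[of j i m \<eta>] assms
        unfolding quiet_before_def by force
    next
      case False
      then have "i < j" using assms by simp
      then show ?thesis
        using a \<open>?y \<in> ?B\<close> arrival_poisson_requests_diff[of i j m \<eta>] assms
        unfolding quiet_after_def by (force simp: abs_minus_commute)
    qed
    then show ?thesis by (simp add: add_increasing)
  qed
  then have "quiet_time m \<eta> i ?x \<le> (\<integral>\<^sup>+ u. indicator {0..?c} u \<partial>lborel)"
    unfolding quiet_time_def by (intro nn_integral_mono) (auto split: split_indicator)
  also have "\<dots> = ennreal ?c" by simp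
  finally show ?thesis .
qed

lemma measurable_quiet_time [measurable]:
  assumes "i < m"
  shows "(\<lambda>\<eta>. quiet_time m \<eta> i x) \<in> borel_measurable (sample_space m)"
proof -
  have [measurable]: "(\<lambda>p. indicator {0..\<rho> x} (snd p) *
     ((if quiet_before (mball x (\<rho> x)) (fst p) i (snd p) then 1 else 0) *
      (if quiet_after (mball x (\<rho> x)) (fst p) i m (snd p) then 1 else 0 :: ennreal)))
     \<in> borel_measurable (sample_space m \<Otimes>\<^sub>M lborel)"
    using measurable_quiet[OF assms order_refl] unfolding case_prod_unfold by measurable
  show ?thesis
    unfolding quiet_time_def by measurable
qed

text \<open>The estimate for quiet periods concerns a fixed set, whereas the ball moves with the
  location of request \<open>i\<close>. Hence the restriction to the event that this location is
  \<open>x\<close>, with its indicator as the weight \<open>h\<close>.\<close>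

lemma expected_quiet_time:
  assumes i: "i < m" and x: "x \<in> X"
  shows "ennreal (lam x / rate) * ennreal (\<rho> x * (1 - exp (- 2)) / 2)
       \<le> (\<integral>\<^sup>+ \<eta>. (if snd (\<eta> i) = x then 1 else 0) * quiet_time m \<eta> i x \<partial>(sample_space m))"
proof -
  let ?B = "mball x (\<rho> x)"
  let ?h = "\<lambda>y. if y = x then 1 else 0 :: ennreal"
  let ?b = "\<lambda>\<eta> u. if quiet_before ?B \<eta> i u then 1 else 0 :: ennreal"
  let ?a = "\<lambda>\<eta> u. if quiet_after ?B \<eta> i m u then 1 else 0 :: ennreal"
  let ?I = "\<lambda>u. indicator {0..\<rho> x} u :: ennreal"
  interpret P: prob_space "sample_space m" by (rule prob_space_poisson)
  interpret PL: pair_sigma_finite "sample_space m" "lborel :: real measure" ..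
  have h [measurable]: "(\<lambda>\<eta>. ?h (snd (\<eta> i))) \<in> borel_measurable (sample_space m)"
    by (rule measurable_fun_of_site[OF i])
  have "ennreal (lam x / rate) * ennreal (\<rho> x * (1 - exp (- 2)) / 2)
      \<le> ennreal (lam x / rate) * (\<integral>\<^sup>+ u. ?I u * ennreal (exp (- (2 * sum lam ?B * u))) \<partial>lborel)"
    by (intro mult_left_mono exp_integral_ge radius_pos x radius_open_ball) auto
  also have "\<dots> = (\<integral>\<^sup>+ u. ?I u * (ennreal (lam x / rate) * ennreal (exp (- (2 * sum lam ?B * u)))) \<partial>lborel)"
    by (subst nn_integral_cmult[symmetric]) (auto simp: ac_simps)
  also have "\<dots> \<le> (\<integral>\<^sup>+ u. (\<integral>\<^sup>+ \<eta>. ?I u * (?h (snd (\<eta> i)) * ?b \<eta> u * ?a \<eta> u) \<partial>(sample_space m)) \<partial>lborel)"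
  proof (rule nn_integral_mono)
    fix u
    have [measurable]: "(\<lambda>\<eta>. ?b \<eta> u) \<in> borel_measurable (sample_space m)"
        "(\<lambda>\<eta>. ?a \<eta> u) \<in> borel_measurable (sample_space m)"
      using i by (auto intro!: measurable_If measurable_quiet_before measurable_quiet_after)
    show "?I u * (ennreal (lam x / rate) * ennreal (exp (- (2 * sum lam ?B * u))))
        \<le> (\<integral>\<^sup>+ \<eta>. ?I u * (?h (snd (\<eta> i)) * ?b \<eta> u * ?a \<eta> u) \<partial>(sample_space m))"
    proof (cases "u \<in> {0..\<rho> x}")
      case True
      have "(\<Sum>y\<in>X. ennreal (lam y / rate) * ?h y) = ennreal (lam x / rate)"
        using finite_X x by (simp add: if_distrib sum.delta' cong: if_cong)
      then have "ennreal (lam x / rate) * ennreal (exp (- (2 * sum lam ?B * u)))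
          \<le> (\<integral>\<^sup>+ \<eta>. ?h (snd (\<eta> i)) * ?b \<eta> u * ?a \<eta> u \<partial>(sample_space m))"
        using nn_integral_quiet[OF mball_subset_mspace _ i, where u=u and h="?h"] True by simp
      then show ?thesis using True by simp
    qed simp
  qed
  also have "\<dots> = (\<integral>\<^sup>+ \<eta>. (\<integral>\<^sup>+ u. ?I u * (?h (snd (\<eta> i)) * ?b \<eta> u * ?a \<eta> u) \<partial>lborel) \<partial>(sample_space m))"
  proof (rule PL.Fubini')
    note measurable_quiet[OF i order_refl, unfolded case_prod_unfold, measurable]
    have [measurable]: "(\<lambda>p. ?h (snd (fst p i))) \<in> borel_measurable (sample_space m \<Otimes>\<^sub>M borel)"
      by (rule measurable_compose[OF measurable_fst h])
    have "(\<lambda>p. ?I (snd p) * (?h (snd (fst p i)) * ?b (fst p) (snd p) * ?a (fst p) (snd p)))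
        \<in> borel_measurable (sample_space m \<Otimes>\<^sub>M borel)"
      by measurable
    then show "(\<lambda>(\<eta>, u). ?I u * (?h (snd (\<eta> i)) * ?b \<eta> u * ?a \<eta> u))
        \<in> borel_measurable (sample_space m \<Otimes>\<^sub>M lborel)"
      by (simp add: case_prod_unfold cong: measurable_cong_sets)
  qed
  also have "\<dots> = (\<integral>\<^sup>+ \<eta>. ?h (snd (\<eta> i)) * quiet_time m \<eta> i x \<partial>(sample_space m))"
  proof (rule nn_integral_cong)
    fix \<eta> assume \<eta>: "\<eta> \<in> space (sample_space m)"
    show "(\<integral>\<^sup>+ u. ?I u * (?h (snd (\<eta> i)) * ?b \<eta> u * ?a \<eta> u) \<partial>lborel) = ?h (snd (\<eta> i)) * quiet_time m \<eta> i x"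
      unfolding quiet_time_def by (cases "snd (\<eta> i) = x") simp_all
  qed
  finally show ?thesis .
qed

text \<open>The 4 combines the 2 from \<open>exp_integral_ge\<close> with the 2 from
  \<open>mpmd_OPT_ge\<close>.\<close>

lemma expected_OPT:
  assumes ev: "even m"
  shows "ennreal (m * (mean_radius * (1 - exp (- 2)) / 4)) \<le> poisson_expectation X lam m (mpmd_OPT d)"
proof -
  let ?h = "\<lambda>x y. if y = x then 1 else 0 :: ennreal"
  \<comment> \<open>Only the term of the actual location survives; each summand has a fixed ball, to
    which \<open>expected_quiet_time\<close> applies.\<close>
  let ?Z = "\<lambda>\<eta> i. \<Sum>x\<in>X. ?h x (snd (\<eta> i)) * quiet_time m \<eta> i x"
  let ?e = "(1 - exp (- 2)) / 2 :: real"
  have [measurable]: "(\<lambda>\<eta>. ?h x (snd (\<eta> i)) * quiet_time m \<eta> i x) \<in> borel_measurable (sample_space m)"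
    if "i \<in> {..<m}" for i x
    using that measurable_fun_of_site[of i m "?h x"] measurable_quiet_time[of i m x]
    by (intro borel_measurable_times_ennreal) auto
  have "ennreal (mean_radius * ?e) \<le> (\<integral>\<^sup>+ \<eta>. ?Z \<eta> i \<partial>(sample_space m))" if "i \<in> {..<m}" for i
  proof -
    have "ennreal (mean_radius * ?e) = ennreal mean_radius * ennreal ?e"
      using mean_radius_pos by (intro ennreal_mult') auto
    also have "\<dots> = (\<Sum>x\<in>X. ennreal (lam x / rate) * ennreal (\<rho> x * (1 - exp (- 2)) / 2))"
      unfolding ennreal_mean_radius[symmetric] sum_distrib_right
      using radius_pos by (intro sum.cong) (auto simp: mult.assoc ennreal_mult'[symmetric] less_imp_le)
    also have "\<dots> \<le> (\<Sum>x\<in>X. \<integral>\<^sup>+ \<eta>. ?h x (snd (\<eta> i)) * quiet_time m \<eta> i x \<partial>(sample_space m))"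
      using that by (intro sum_mono expected_quiet_time) auto
    also have "\<dots> = (\<integral>\<^sup>+ \<eta>. ?Z \<eta> i \<partial>(sample_space m))"
      using that by (intro nn_integral_sum[symmetric]) measurable
    finally show ?thesis .
  qed
  then have "(\<Sum>i<m. ennreal (mean_radius * ?e)) \<le> (\<Sum>i<m. \<integral>\<^sup>+ \<eta>. ?Z \<eta> i \<partial>(sample_space m))"
    by (rule sum_mono)
  also have "\<dots> = (\<integral>\<^sup>+ \<eta>. (\<Sum>i<m. ?Z \<eta> i) \<partial>(sample_space m))"
    by (intro nn_integral_sum[symmetric]) measurable
  finally have 1: "(\<Sum>i<m. ennreal (mean_radius * ?e)) \<le> (\<integral>\<^sup>+ \<eta>. (\<Sum>i<m. ?Z \<eta> i) \<partial>(sample_space m))" .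
  have "ennreal (m * (mean_radius * (1 - exp (- 2)) / 4)) = (\<Sum>i<m. ennreal (mean_radius * ?e)) * ennreal (1 / 2)"
  proof -
    have "(\<Sum>i<m. ennreal (mean_radius * ?e)) = ennreal (m * (mean_radius * ?e))"
      using mean_radius_pos by (simp add: ennreal_of_nat_eq_real_of_nat ennreal_mult'[symmetric])
    moreover have "ennreal (m * (mean_radius * ?e)) * ennreal (1 / 2) = ennreal (m * (mean_radius * ?e) * (1 / 2))"
      using mean_radius_pos by (intro ennreal_mult'[symmetric]) auto
    ultimately show ?thesis by (simp only:) (simp add: field_simps)
  qed
  also have "\<dots> \<le> (\<integral>\<^sup>+ \<eta>. (\<Sum>i<m. ?Z \<eta> i) \<partial>(sample_space m)) * ennreal (1 / 2)"
    by (intro mult_right_mono 1) auto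
  also have "\<dots> = (\<integral>\<^sup>+ \<eta>. (\<Sum>i<m. ?Z \<eta> i) * ennreal (1 / 2) \<partial>(sample_space m))"
    by (intro nn_integral_multc[symmetric]) measurable
  also have "\<dots> \<le> poisson_expectation X lam m (mpmd_OPT d)"
    unfolding poisson_expectation_def
  proof (rule nn_integral_mono)
    fix \<eta> assume \<eta>: "\<eta> \<in> space (sample_space m)"
    let ?\<sigma> = "poisson_requests m \<eta>"
    define z where "z i = enn2real (quiet_time m \<eta> i (snd (\<eta> i)))" for i
    have Z: "?Z \<eta> i = ennreal (z i)" if "i < m" for i
    proof -
      have "?Z \<eta> i = (\<Sum>x\<in>X. if snd (\<eta> i) = x then quiet_time m \<eta> i x else 0)"
        by (intro sum.cong) auto
      also have "\<dots> = quiet_time m \<eta> i (snd (\<eta> i))"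
        using finite_X site_in_X[OF \<eta> that] by simp
      also have "\<dots> = ennreal (z i)"
      proof -
        \<comment> \<open>Finiteness matters, because \<open>enn2real\<close> would send infinity to
          0.\<close>
        have "quiet_time m \<eta> i (snd (\<eta> i)) \<le> (\<integral>\<^sup>+ u. indicator {0..\<rho> (snd (\<eta> i))} u \<partial>lborel)"
          unfolding quiet_time_def by (intro nn_integral_mono) (auto split: split_indicator)
        also have "\<dots> < top"
          using radius_pos[OF site_in_X[OF \<eta> that]] by simp
        finally show ?thesis unfolding z_def by simp
      qed
      finally show ?thesis .
    qed
    have "(\<Sum>i<length ?\<sigma>. z i) / 2 \<le> mpmd_OPT d ?\<sigma>"
    proof (rule mpmd_OPT_ge)
      fix i j assume ij: "i < length ?\<sigma>" "j < length ?\<sigma>" "i \<noteq> j"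
      then show "z i \<le> d (loc ?\<sigma> i) (loc ?\<sigma> j) + \<bar>arrival ?\<sigma> i - arrival ?\<sigma> j\<bar>"
        using quiet_time_le[of i m j \<eta>] \<eta> unfolding z_def
        by (intro enn2real_leI) (auto simp: loc_poisson_requests)
    qed (use ev commute in auto)
    then have "ennreal ((\<Sum>i<m. z i) / 2) \<le> ennreal (mpmd_OPT d ?\<sigma>)" by (simp add: ennreal_leI)
    moreover have "(\<Sum>i<m. ?Z \<eta> i) * ennreal (1 / 2) = ennreal ((\<Sum>i<m. z i) / 2)"
    proof -
      have "(\<Sum>i<m. ?Z \<eta> i) = ennreal (\<Sum>i<m. z i)"
        using Z by (simp add: z_def)
      moreover have "ennreal (\<Sum>i<m. z i) * ennreal (1 / 2) = ennreal ((\<Sum>i<m. z i) * (1 / 2))"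
        by (intro ennreal_mult'[symmetric]) (auto simp: z_def sum_nonneg)
      ultimately show ?thesis by (simp only:) simp
    qed
    ultimately show "(\<Sum>i<m. ?Z \<eta> i) * ennreal (1 / 2) \<le> ennreal (mpmd_OPT d ?\<sigma>)" by simp
  qed
  finally show ?thesis .
qed

end

theorem theorem2:
  fixes X :: "'a set" and d :: "'a \<Rightarrow> 'a \<Rightarrow> real" and lam :: "'a \<Rightarrow> real"
    and tie :: "'a request list \<Rightarrow> nat set \<Rightarrow> nat"
    and fin :: "'a request list \<Rightarrow> nat set \<Rightarrow> (nat \<times> nat) set"
  assumes "Metric_space X d" and "finite X" and "X \<noteq> {}"
    and "\<forall>x\<in>X. 0 < lam x"
    and "tie_rule tie" and "final_rule fin"
  shows "limsup (\<lambda>k. poisson_expectation X lam (2 * k) (radius_cost X d lam tie fin)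
                    / poisson_expectation X lam (2 * k) (mpmd_OPT d))
         \<le> ennreal (8 / (1 - exp (- 2)))"
proof -
  interpret Metric_space X d by fact
  interpret mpmd_metric X lam d
    using assms by unfold_locales auto
  define e :: real where "e = 1 - exp (- 2)"
  have e: "0 < e" by (simp add: e_def)
  define S where "S = mean_radius"
  have S: "0 < S" using mean_radius_pos by (simp add: S_def)
  define D where "D = (\<Sum>(x, y)\<in>X \<times> X. d x y)"
  have D: "0 \<le> D" unfolding D_def by (intro sum_nonneg) auto
  let ?R = "\<lambda>k. poisson_expectation X lam (2 * k) (radius_cost X d lam tie fin)
              / poisson_expectation X lam (2 * k) (mpmd_OPT d)"
  \<comment> \<open>The quotient of the two bounds for length \<open>2 * k\<close>, namely
    \<open>4 * k * S + D\<close> over \<open>k * S * e / 2\<close>. The term from the leftover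
    requests vanishes as \<open>k\<close> grows.\<close>
  let ?b = "\<lambda>k::nat. 8 / e + 2 * D / (k * S * e)"
  have "?R k \<le> ennreal (?b k)" if k: "0 < k" for k
  proof -
    let ?c = "k * S * e / 2"
    have c: "0 < ?c" using k S e by simp
    have opt: "ennreal ?c \<le> poisson_expectation X lam (2 * k) (mpmd_OPT d)"
      using expected_OPT[of "2 * k"] by (simp add: S_def e_def mult.assoc)
    show ?thesis
    proof (rule divide_le_posI_ennreal)
      show "0 < poisson_expectation X lam (2 * k) (mpmd_OPT d)"
        using opt c by (metis ennreal_less_zero_iff less_le_trans)
      have "poisson_expectation X lam (2 * k) (radius_cost X d lam tie fin) \<le> ennreal (4 * k * S + D)"
        using expected_radius_cost[OF assms(5,6), of "2 * k"] by (simp add: S_def D_def)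
      also have "4 * k * S + D = ?b k * ?c"
        using k S e by (simp add: field_simps)
      also have "ennreal (?b k * ?c) = ennreal (?b k) * ennreal ?c"
        using k S e D by (intro ennreal_mult) auto
      also have "\<dots> \<le> ennreal (?b k) * poisson_expectation X lam (2 * k) (mpmd_OPT d)"
        by (intro mult_left_mono opt) simp
      finally show "poisson_expectation X lam (2 * k) (radius_cost X d lam tie fin)
          \<le> poisson_expectation X lam (2 * k) (mpmd_OPT d) * ennreal (?b k)"
        by (simp only: mult.commute)
    qed
  qed
  then have "eventually (\<lambda>k. ?R k \<le> ennreal (?b k)) sequentially"
    by (intro eventually_mono[OF eventually_gt_at_top[of "0 :: nat"]])
  then have "limsup ?R \<le> limsup (\<lambda>k. ennreal (?b k))"
    by (rule Limsup_mono)
  also have "\<dots> = ennreal (8 / e)"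
  proof (intro lim_imp_Limsup tendsto_ennrealI)
    show "?b \<longlonglongrightarrow> 8 / e" using S e by real_asymp
  qed simp
  finally show ?thesis by (simp add: e_def)
qed

end
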